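(* Let $n\ge1$ and let the prior be $p\in(0,1)$. Let $\mathcal Q^\star$ be the set of tuples of one-dimensional marginals of nested bi-upset signals: $$\mathcal Q^\star:=\Big\{(q_1,\dots,q_n):\ \exists f\in\mathcal F^\star\ \text{such that}\ q_i(s_i)=\int f(s_i,s_{-i})\,ds_{-i}\ \text{for all } i\Big\}.$$ A belief distribution $(\mu_1,\dots,\mu_n)$ is feasible under the constraint of privacy if and only if its associated quantile functions $(q_1,\dots,q_n)$ lie in the closed convex hull $\mathrm{cl}(\mathrm{co}(\mathcal Q^\star))$; moreover, the set of extreme points of $\mathrm{cl}(\mathrm{co}(\mathcal Q^\star))$ is contained in $\mathcal Q^\star$.
   Context: The state is $\omega\in\{0,1\}$ with prior $p=\mathbb P(\omega=1)\in(0,1)$. An information structure is a tuple of random variables $(\omega,s_1,\dots,s_n)$ on a common probability space, where $s_i$ takes values in a measurable space $S_i$; it is a private private information structure if $s_1,\dots,s_n$ are independent random variables (unconditionally). Let $p_i(s_i):=\mathbb P(\omega=1\mid s_i)$. A belief distribution $(\mu_1,\dots,\mu_n)$, each $\mu_i$ a Borel probability measure on $[0,1]$, is feasible under the constraint of privacy if there is a private private information structure such that $\mu_i$ is the distribution of $p_i(s_i)$ for every $i$. The associated quantile functions are the quantile functions $q_i:[0,1]\to[0,1]$ of $\mu_i$. Let $\mathcal F^p$ be the set of (measurable) functions $f:[0,1]^n\to[0,1]$ with $\int f(s)\,ds=p$. A set $A\subseteq[0,1]^n$ is an up-set if $x\in A$, $y\ge x$ (component-wise) imply $y\in A$. $f\in\mathcal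 F^p$ is a nested bi-upset signal if $f=\mathbf 1_{A_1}+\lambda\mathbf 1_{A_2\setminus A_1}$ for two nested up-sets $A_1\subseteq A_2$ and some $\lambda\in[0,1]$; $\mathcal F^\star\subset\mathcal F^p$ is the set of nested bi-upset signals. Functions equal almost everywhere are identified, and the closure is in the $L^1$ topology. *)

theory Defs
  imports "HOL-Probability.Probability"
begin

definition unit_interval :: "real measure" where
  "unit_interval = restrict_space lborel {0..1}"

lemma space_unit_interval [simp]: "space unit_interval = {0..1}"
  by (simp add: unit_interval_def space_restrict_space)

lemma prob_space_unit_interval: "prob_space unit_interval"
  by (rule prob_spaceI) (simp add: unit_interval_def space_restrict_space emeasure_restrict_space)

definition L1_eq :: "(real \<Rightarrow> real) \<Rightarrow> (real \<Rightarrow> real) \<Rightarrow> bool" where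
  "L1_eq f g \<longleftrightarrow> integrable unit_interval f \<and> integrable unit_interval g
     \<and> (AE t in unit_interval. f t = g t)"

lemma part_equivp_L1_eq: "part_equivp L1_eq"
proof (rule part_equivpI)
  show "\<exists>f. L1_eq f f"
    by (rule exI[of _ "\<lambda>_. 0"]) (simp add: L1_eq_def)
  show "symp L1_eq"
    by (auto simp: symp_def L1_eq_def eq_commute)
  show "transp L1_eq"
    unfolding transp_def L1_eq_def by (auto elim: AE_mp)
qed

quotient_type L1 = "real \<Rightarrow> real" / partial: L1_eq
  morphisms rep_L1 L1_class
  by (rule part_equivp_L1_eq)

lemma L1_eq_refl: "integrable unit_interval f \<Longrightarrow> L1_eq f f"
  by (simp add: L1_eq_def)

lemma L1_class_eq_iff:
  assumes "integrable unit_interval f" "integrable unit_interval g"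
  shows "L1_class f = L1_class g \<longleftrightarrow> (AE t in unit_interval. f t = g t)"
  using Quotient3_rel[OF Quotient3_L1, of f g] assms by (simp add: L1_eq_def)

instantiation L1 :: real_normed_vector
begin

lift_definition zero_L1 :: L1 is "\<lambda>_. 0"
  by (simp add: L1_eq_def)

lift_definition plus_L1 :: "L1 \<Rightarrow> L1 \<Rightarrow> L1" is "\<lambda>f g t. f t + g t"
  by (auto simp: L1_eq_def)

lift_definition minus_L1 :: "L1 \<Rightarrow> L1 \<Rightarrow> L1" is "\<lambda>f g t. f t - g t"
  by (auto simp: L1_eq_def)

lift_definition uminus_L1 :: "L1 \<Rightarrow> L1" is "\<lambda>f t. - f t"
  by (auto simp: L1_eq_def)

lift_definition scaleR_L1 :: "real \<Rightarrow> L1 \<Rightarrow> L1" is "\<lambda>c f t. c * f t"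
  by (auto simp: L1_eq_def)

lift_definition norm_L1 :: "L1 \<Rightarrow> real" is "\<lambda>f. \<integral>t. \<bar>f t\<bar> \<partial>unit_interval"
  unfolding L1_eq_def by (intro integral_cong_AE) auto

definition sgn_L1 :: "L1 \<Rightarrow> L1"
  where "sgn_L1 x = scaleR (inverse (norm x)) x"

definition dist_L1 :: "L1 \<Rightarrow> L1 \<Rightarrow> real"
  where "dist_L1 x y = norm (x - y)"

definition uniformity_L1 :: "(L1 \<times> L1) filter"
  where "uniformity_L1 = (INF e\<in>{0 <..}. principal {(x, y). dist x y < e})"

definition open_L1 :: "L1 set \<Rightarrow> bool"
  where "open_L1 S = (\<forall>x\<in>S. \<forall>\<^sub>F (x', y) in uniformity. x' = x \<longrightarrow> y \<in> S)"

instance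
proof
  fix a b c :: L1 and r s :: real and S :: "L1 set"
  show "a + b + c = a + (b + c)" by transfer (auto simp: L1_eq_def add.assoc)
  show "a + b = b + a" by transfer (auto simp: L1_eq_def add.commute)
  show "0 + a = a" by transfer (auto simp: L1_eq_def)
  show "- a + a = 0" by transfer (auto simp: L1_eq_def)
  show "a - b = a + - b" by transfer (auto simp: L1_eq_def)
  show "r *\<^sub>R (a + b) = r *\<^sub>R a + r *\<^sub>R b" by transfer (auto simp: L1_eq_def distrib_left)
  show "(r + s) *\<^sub>R a = r *\<^sub>R a + s *\<^sub>R a" by transfer (auto simp: L1_eq_def distrib_right)
  show "r *\<^sub>R s *\<^sub>R a = (r * s) *\<^sub>R a" by transfer (auto simp: L1_eq_def mult.assoc)
  show "1 *\<^sub>R a = a" by transfer (auto simp: L1_eq_def)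
  show "sgn a = inverse (norm a) *\<^sub>R a" by (rule sgn_L1_def)
  show "dist a b = norm (a - b)" by (rule dist_L1_def)
  show "uniformity = (INF e\<in>{0 <..}. principal {(x :: L1, y). dist x y < e})"
    by (rule uniformity_L1_def)
  show "open S = (\<forall>x\<in>S. \<forall>\<^sub>F (x', y) in uniformity. x' = x \<longrightarrow> y \<in> S)"
    by (rule open_L1_def)
  show "norm a = 0 \<longleftrightarrow> a = 0"
    by transfer (auto simp: L1_eq_def integral_nonneg_eq_0_iff_AE)
  show "norm (a + b) \<le> norm a + norm b"
  proof transfer
    fix f g assume "L1_eq f f" "L1_eq g g"
    then have fg: "integrable unit_interval f" "integrable unit_interval g"
      by (auto simp: L1_eq_def)
    have "(\<integral>t. \<bar>f t + g t\<bar> \<partial>unit_interval) \<le> (\<integral>t. \<bar>f t\<bar> + \<bar>g t\<bar> \<partial>unit_interval)"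
      using fg by (intro integral_mono) auto
    then show "(\<integral>t. \<bar>f t + g t\<bar> \<partial>unit_interval)
        \<le> (\<integral>t. \<bar>f t\<bar> \<partial>unit_interval) + (\<integral>t. \<bar>g t\<bar> \<partial>unit_interval)"
      using fg by simp
  qed
  show "norm (r *\<^sub>R a) = \<bar>r\<bar> * norm a"
    by transfer (simp add: abs_mult)
qed

end

definition information_structure ::
  "real \<Rightarrow> 'w measure \<Rightarrow> ('w \<Rightarrow> nat) \<Rightarrow> ('n \<Rightarrow> 's measure) \<Rightarrow> ('n \<Rightarrow> 'w \<Rightarrow> 's) \<Rightarrow> bool" where
  "information_structure p M \<omega> S s \<longleftrightarrow>
     prob_space M \<and>
     \<omega> \<in> M \<rightarrow>\<^sub>M count_space {0, 1} \<and>
     measure M {w \<in> space M. \<omega> w = 1} = p \<and>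
     (\<forall>i. s i \<in> M \<rightarrow>\<^sub>M S i)"

definition private_private ::
  "real \<Rightarrow> 'w measure \<Rightarrow> ('w \<Rightarrow> nat) \<Rightarrow> ('n \<Rightarrow> 's measure) \<Rightarrow> ('n \<Rightarrow> 'w \<Rightarrow> 's) \<Rightarrow> bool" where
  "private_private p M \<omega> S s \<longleftrightarrow>
     information_structure p M \<omega> S s \<and> prob_space.indep_vars M S s UNIV"

text \<open>
  The version of \<open>\<P>(\<omega> = 1 | s\<^sub>i)\<close> chosen here is a function of the sample point, measurable
  with respect to the \<open>\<sigma>\<close>-algebra generated by \<open>s\<^sub>i\<close>; its law does not depend on the version.
\<close>

definition posterior ::
  "'w measure \<Rightarrow> ('w \<Rightarrow> nat) \<Rightarrow> ('n \<Rightarrow> 's measure) \<Rightarrow> ('n \<Rightarrow> 'w \<Rightarrow> 's) \<Rightarrow> 'n \<Rightarrow> 'w \<Rightarrow> real" where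
  "posterior M \<omega> S s i =
     real_cond_exp M (vimage_algebra (space M) (s i) (S i)) (indicator {w \<in> space M. \<omega> w = 1})"

definition belief_distribution :: "('n \<Rightarrow> real measure) \<Rightarrow> bool" where
  "belief_distribution \<mu> \<longleftrightarrow>
     (\<forall>i. prob_space (\<mu> i) \<and> sets (\<mu> i) = sets borel \<and> measure (\<mu> i) {0..1} = 1)"

text \<open>
  HOL cannot quantify existentially over types, so the types \<open>'w\<close> of sample points and \<open>'s\<close> of
  signals are parameters. Signal spaces \<open>S i\<close> that differ can all be measures on one sum type.
\<close>

definition feasible_privately ::
  "'w itself \<Rightarrow> 's itself \<Rightarrow> real \<Rightarrow> ('n \<Rightarrow> real measure) \<Rightarrow> bool" where
  "feasible_privately _ _ p \<mu> \<longleftrightarrow>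
     (\<exists>(M :: 'w measure) \<omega> (S :: 'n \<Rightarrow> 's measure) s.
        private_private p M \<omega> S s \<and> (\<forall>i. distr M borel (posterior M \<omega> S s i) = \<mu> i))"

definition quantile :: "real measure \<Rightarrow> real \<Rightarrow> real" where
  "quantile \<nu> t = Inf {x \<in> {0..1}. t \<le> measure \<nu> {..x}}"

text \<open>
  \<open>L1 ^ 'n\<close> carries the Euclidean norm of the componentwise \<open>L\<^sup>1\<close> norms, so its topology is the
  product of the \<open>L\<^sup>1\<close> topologies.
\<close>

definition quantile_tuple :: "('n::finite \<Rightarrow> real measure) \<Rightarrow> L1 ^ 'n" where
  "quantile_tuple \<mu> = (\<chi> i. L1_class (quantile (\<mu> i)))"

definition cube :: "'n set \<Rightarrow> ('n \<Rightarrow> real) measure" where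
  "cube I = Pi\<^sub>M I (\<lambda>_. unit_interval)"

definition signals :: "real \<Rightarrow> (('n::finite \<Rightarrow> real) \<Rightarrow> real) set" where
  "signals p = {f \<in> borel_measurable (cube UNIV).
     (\<forall>x \<in> space (cube UNIV). f x \<in> {0..1}) \<and> (\<integral>x. f x \<partial>cube UNIV) = p}"

definition up_set :: "('n::finite \<Rightarrow> real) set \<Rightarrow> bool" where
  "up_set A \<longleftrightarrow> A \<subseteq> space (cube UNIV) \<and>
     (\<forall>x \<in> A. \<forall>y \<in> space (cube UNIV). x \<le> y \<longrightarrow> y \<in> A)"

text \<open>
  Signals that agree almost everywhere are identified. This also makes the Borel measurability in
  \<^const>\<open>signals\<close> harmless: up-sets are Lebesgue measurable, but not Borel in general.
\<close>

definition nested_bi_upset_signals :: "real \<Rightarrow> (('n::finite \<Rightarrow> real) \<Rightarrow> real) set" where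
  "nested_bi_upset_signals p = {f \<in> signals p. \<exists>A\<^sub>1 A\<^sub>2 c.
     up_set A\<^sub>1 \<and> up_set A\<^sub>2 \<and> A\<^sub>1 \<subseteq> A\<^sub>2 \<and> c \<in> {0..1} \<and>
     (AE x in cube UNIV. f x = indicator A\<^sub>1 x + c * indicator (A\<^sub>2 - A\<^sub>1) x)}"

text \<open>Points of \<^term>\<open>cube (UNIV - {i})\<close> are \<open>undefined\<close> at \<open>i\<close>; the update fills that slot.\<close>

definition marginal :: "(('n::finite \<Rightarrow> real) \<Rightarrow> real) \<Rightarrow> 'n \<Rightarrow> real \<Rightarrow> real" where
  "marginal f i t = (\<integral>x. f (x(i := t)) \<partial>cube (UNIV - {i}))"

definition Q_star :: "real \<Rightarrow> (L1 ^ 'n::finite) set" where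
  "Q_star p = {\<chi> i. L1_class (marginal f i) | f. f \<in> nested_bi_upset_signals p}"

text \<open>\<^const>\<open>L1_class\<close> is only meaningful on integrable functions; it is applied to such above.\<close>

lemma integrable_unit_interval_bounded:
  assumes "f \<in> borel_measurable unit_interval" "\<And>t. t \<in> {0..1} \<Longrightarrow> f t \<in> {0..1::real}"
  shows "integrable unit_interval f"
proof -
  interpret prob_space unit_interval by (rule prob_space_unit_interval)
  show ?thesis
    by (rule integrable_const_bound[where B = 1]) (use assms in \<open>auto intro!: AE_I2\<close>)
qed

lemma integrable_quantile:
  assumes "prob_space \<nu>" "sets \<nu> = sets borel" "measure \<nu> {0..1} = 1"
  shows "integrable unit_interval (quantile \<nu>)"
proof (rule integrable_unit_interval_bounded)
  interpret \<nu>: prob_space \<nu> by fact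
  have "measure \<nu> {0..1} \<le> measure \<nu> {..1}"
    by (rule \<nu>.finite_measure_mono) (auto simp: assms)
  then have one: "1 \<in> {x \<in> {0..1}. t \<le> measure \<nu> {..x}}" if "t \<in> {0..1}" for t
    using that assms(3) by auto
  have bdd: "bdd_below {x \<in> {0..1::real}. t \<le> measure \<nu> {..x}}" for t
    by (rule bdd_belowI[of _ 0]) auto
  show "quantile \<nu> t \<in> {0..1}" if "t \<in> {0..1}" for t
    unfolding quantile_def using one[OF that] bdd[of t]
    by (auto intro!: cInf_lower cInf_greatest)
  have "mono_on {0..1} (quantile \<nu>)"
    unfolding quantile_def
    by (rule mono_onI, rule cInf_superset_mono) (use one bdd in blast, auto intro!: bdd_belowI[of _ 0])
  from borel_measurable_mono_on_fnc[OF this]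
  show "quantile \<nu> \<in> borel_measurable unit_interval"
    by (simp add: unit_interval_def measurable_def space_restrict_space sets_restrict_space)
qed

lemma integrable_marginal:
  fixes f :: "('n::finite \<Rightarrow> real) \<Rightarrow> real"
  assumes "f \<in> signals p"
  shows "integrable unit_interval (marginal f i)"
proof (rule integrable_unit_interval_bounded)
  interpret J: prob_space "cube (UNIV - {i})"
    unfolding cube_def by (rule prob_space_PiM) (rule prob_space_unit_interval)
  have f [measurable]: "f \<in> borel_measurable (Pi\<^sub>M UNIV (\<lambda>_. unit_interval))"
    and bound: "\<And>x. x \<in> space (cube UNIV) \<Longrightarrow> f x \<in> {0..1}"
    using assms by (auto simp: signals_def cube_def)
  have upd: "(\<lambda>(t, x). x(i := t)) \<in>
      unit_interval \<Otimes>\<^sub>M cube (UNIV - {i}) \<rightarrow>\<^sub>M Pi\<^sub>M UNIV (\<lambda>_. unit_interval)"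
    unfolding cube_def split_beta
    by (rule measurable_fun_upd[where J = "UNIV - {i}"]) auto
  show "marginal f i \<in> borel_measurable unit_interval"
    unfolding marginal_def
    by (rule J.borel_measurable_lebesgue_integral)
       (use measurable_compose[OF upd f] in \<open>simp add: split_beta'\<close>)
  fix t :: real assume t: "t \<in> {0..1}"
  have in_cube: "x(i := t) \<in> space (cube UNIV)" if "x \<in> space (cube (UNIV - {i}))" for x
    using that t by (auto simp: cube_def space_PiM PiE_def Pi_def)
  have "(\<lambda>x. x(i := t)) \<in> cube (UNIV - {i}) \<rightarrow>\<^sub>M Pi\<^sub>M UNIV (\<lambda>_. unit_interval)"
    unfolding cube_def by (rule measurable_fun_upd[where J = "UNIV - {i}"]) (use t in auto)
  from measurable_compose[OF this f]
  have int: "integrable (cube (UNIV - {i})) (\<lambda>x. f (x(i := t)))"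
    using bound in_cube by (intro J.integrable_const_bound[where B = 1]) (auto intro!: AE_I2)
  show "marginal f i t \<in> {0..1}"
    unfolding marginal_def
    using bound in_cube int
    by (auto intro!: Bochner_Integration.integral_nonneg_AE J.integral_le_const AE_I2)
qed

end

theory Submission
  imports Defs
begin

text \<open>
  The closed convex hull turns out to be the set of marginal tuples of the signals that are monotone
  almost everywhere. This set is convex, and closed because signals of nearly minimal \<open>L\<^sup>2\<close> norm
  converge; conversely, a monotone signal is close to an average of indicators of its level sets,
  and a weighted average with mean \<open>p\<close> splits into pairs of level sets with mean \<open>p\<close>, which are
  nested bi-upset signals.

  A signal realises its marginals by letting it be the conditional probability of \<open>\<omega> = 1\<close> given
  independent uniform signals. Conversely, rounding the posteriors of a private structure to a grid
  gives a table of conditional probabilities of \<open>\<omega> = 1\<close> with increasing slab averages. The table of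
  least sum of squares with the same slab averages is monotone.

  If \<open>f\<close> is monotone with an extreme marginal tuple, write \<open>f\<close> as a proper convex combination of
  \<open>\<psi> \<circ> f\<close> and another monotone signal, where \<open>\<psi>\<close> is a ramp of slope \<open>k\<close>. Then \<open>\<psi> \<circ> f\<close> has the same
  marginals as \<open>f\<close>, and it tends to a nested bi-upset signal along a subsequence as \<open>k \<rightarrow> \<infinity>\<close>.
\<close>

section \<open>Signals and their marginals\<close>

text \<open>The signal behind a tuple of marginals is far from unique, and this shapes the proof. An
  arbitrary choice of signals need not converge when their marginals do, so a choice is made by
  nearly least L2 norm. Passing to marginals is linear and an L1 contraction in each component,
  hence midpoints stay admissible and a.e. limits pass through. For the same reason an extreme tuple
  may come from a signal that is not a nested bi-upset signal; the signal has to be replaced without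
  moving its marginals.

  The quantile function of a belief distribution pushes the uniform law forward to it, so a signal
  whose marginals are the quantile functions produces the right posteriors. Conversely, marginals
  see a table of conditional probabilities only through its averages over slabs, so it may be
  rearranged as long as these are kept. Quantile functions are increasing, so a table monotone in
  the cells gives a signal monotone in the uniform variables.

  Rounding a signal down to finitely many levels lowers its mean; \<open>p < 1\<close> leaves room
  to restore it by mixing in the constant 1.\<close>

definition marginals :: "(('n::finite \<Rightarrow> real) \<Rightarrow> real) \<Rightarrow> L1 ^ 'n" where
  "marginals f = (\<chi> i. L1_class (marginal f i))"

text \<open>The mean is left free, unlike in \<open>signals\<close>: level-set indicators of a
  signal with mean \<open>p\<close> have other means.\<close>

definition unit_valued :: "(('n::finite \<Rightarrow> real) \<Rightarrow> real) \<Rightarrow> bool" where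
  "unit_valued f \<longleftrightarrow> f \<in> borel_measurable (cube UNIV) \<and> (\<forall>x\<in>space (cube UNIV). f x \<in> {0..1})"

lemma signals_eq: "signals p = {f. unit_valued f \<and> (\<integral>x. f x \<partial>cube UNIV) = p}"
  by (auto simp: signals_def unit_valued_def)

lemma unit_valued_measurable [measurable_dest]: "unit_valued f \<Longrightarrow> f \<in> borel_measurable (cube UNIV)"
  by (simp add: unit_valued_def)

lemma unit_valued_bounds:
  "unit_valued f \<Longrightarrow> x \<in> space (cube UNIV) \<Longrightarrow> 0 \<le> f x"
  "unit_valued f \<Longrightarrow> x \<in> space (cube UNIV) \<Longrightarrow> f x \<le> 1"
  by (auto simp: unit_valued_def)

lemma prob_space_cube: "prob_space (cube I)"
  unfolding cube_def by (rule prob_space_PiM) (rule prob_space_unit_interval)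

interpretation cube: prob_space "cube I" for I :: "'n set"
  by (rule prob_space_cube)

interpretation unit_interval: prob_space unit_interval
  by (rule prob_space_unit_interval)

lemma space_cube: "space (cube I) = PiE I (\<lambda>_. {0..1})"
  by (simp add: cube_def space_PiM)

text \<open>Splitting off coordinate \<open>i\<close> makes \<open>marginal f i\<close> an inner
  integral, so that Fubini applies to it.\<close>

lemma cube_split:
  fixes i :: "'n::finite"
  shows "cube UNIV = distr (unit_interval \<Otimes>\<^sub>M cube (UNIV - {i})) (cube UNIV) (\<lambda>(t, x). x(i := t))"
proof -
  have *: "insert i (UNIV - {i}) = UNIV" by auto
  show ?thesis
    using distr_pair_PiM_eq_PiM[of "UNIV - {i}" "\<lambda>_. unit_interval" i]
    by (simp add: * cube_def prob_space_unit_interval)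
qed

lemma measurable_cube_update:
  fixes i :: "'n::finite"
  shows "(\<lambda>(t, x). x(i := t)) \<in> unit_interval \<Otimes>\<^sub>M cube (UNIV - {i}) \<rightarrow>\<^sub>M cube UNIV"
  unfolding cube_def split_beta by (rule measurable_fun_upd[where J = "UNIV - {i}"]) auto

lemma cube_update_in_space:
  "t \<in> {0..1} \<Longrightarrow> x \<in> space (cube (UNIV - {i})) \<Longrightarrow> x(i := t) \<in> space (cube UNIV)"
  by (auto simp: space_cube PiE_def Pi_def)

lemma integrable_cube_bounded:
  assumes "h \<in> borel_measurable (cube I)" "\<And>x. x \<in> space (cube I) \<Longrightarrow> \<bar>h x\<bar> \<le> (B::real)"
  shows "integrable (cube I) h"
  by (rule cube.integrable_const_bound[where B = B]) (use assms in auto)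

lemma cube_Fubini:
  fixes h :: "('n::finite \<Rightarrow> real) \<Rightarrow> real"
  assumes h: "h \<in> borel_measurable (cube UNIV)"
    and B: "\<And>x. x \<in> space (cube UNIV) \<Longrightarrow> \<bar>h x\<bar> \<le> B"
  shows "integrable unit_interval (\<lambda>t. \<integral>x. h (x(i := t)) \<partial>cube (UNIV - {i}))"
    and "(\<integral>t. (\<integral>x. h (x(i := t)) \<partial>cube (UNIV - {i})) \<partial>unit_interval) = (\<integral>x. h x \<partial>cube UNIV)"
proof -
  interpret P: pair_sigma_finite unit_interval "cube (UNIV - {i})" by standard
  have int: "integrable (unit_interval \<Otimes>\<^sub>M cube (UNIV - {i})) (\<lambda>z. h ((\<lambda>(t, x). x(i := t)) z))"
    by (rule integrable_distr[OF measurable_cube_update])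
       (use integrable_cube_bounded[OF h B] cube_split[of i] in simp)
  have int': "integrable (unit_interval \<Otimes>\<^sub>M cube (UNIV - {i})) (\<lambda>(t, x). h (x(i := t)))"
    using int by (simp add: split_beta')
  show "integrable unit_interval (\<lambda>t. \<integral>x. h (x(i := t)) \<partial>cube (UNIV - {i}))"
    using P.integrable_fst[OF int'] .
  have "(\<integral>x. h x \<partial>cube UNIV) = (\<integral>z. h ((\<lambda>(t, x). x(i := t)) z) \<partial>(unit_interval \<Otimes>\<^sub>M cube (UNIV - {i})))"
    by (subst cube_split[of i], rule integral_distr[OF measurable_cube_update h])
  also have "\<dots> = (\<integral>t. (\<integral>x. h (x(i := t)) \<partial>cube (UNIV - {i})) \<partial>unit_interval)"
    using P.integral_fst[OF int'] by (simp add: split_beta')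
  finally show "(\<integral>t. (\<integral>x. h (x(i := t)) \<partial>cube (UNIV - {i})) \<partial>unit_interval) = (\<integral>x. h x \<partial>cube UNIV)"
    by simp
qed

lemma section_integrable:
  fixes h :: "('n::finite \<Rightarrow> real) \<Rightarrow> real"
  assumes h: "h \<in> borel_measurable (cube UNIV)"
    and B: "\<And>x. x \<in> space (cube UNIV) \<Longrightarrow> \<bar>h x\<bar> \<le> B" and t: "t \<in> {0..1}"
  shows "integrable (cube (UNIV - {i})) (\<lambda>x. h (x(i := t)))"
proof (rule integrable_cube_bounded)
  have "(\<lambda>x. (t, x)) \<in> cube (UNIV - {i}) \<rightarrow>\<^sub>M unit_interval \<Otimes>\<^sub>M cube (UNIV - {i})"
    using t by simp
  from measurable_compose[OF measurable_compose[OF this measurable_cube_update] h]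
  show "(\<lambda>x. h (x(i := t))) \<in> borel_measurable (cube (UNIV - {i}))" by simp
qed (rule B, rule cube_update_in_space[OF t])

lemma unit_valued_section_integrable:
  assumes "unit_valued f" "t \<in> {0..1}"
  shows "integrable (cube (UNIV - {i})) (\<lambda>x. f (x(i := t)))"
  by (rule section_integrable[where B = 1])
     (use assms unit_valued_bounds[OF assms(1)] unit_valued_measurable in auto)

lemma unit_valued_integrable:
  assumes "unit_valued f"
  shows "integrable (cube UNIV) f"
  by (rule integrable_cube_bounded[where B = 1])
     (use assms unit_valued_bounds[OF assms(1)] unit_valued_measurable in auto)

lemma unit_valued_integrable_marginal:
  "unit_valued f \<Longrightarrow> integrable unit_interval (marginal f i)"
  by (rule integrable_marginal[where p = "\<integral>x. f x \<partial>cube UNIV"]) (simp add: signals_eq)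

lemma norm_L1_class_diff:
  assumes "integrable unit_interval f" "integrable unit_interval g"
  shows "norm (L1_class f - L1_class g) = (\<integral>t. \<bar>f t - g t\<bar> \<partial>unit_interval)"
  using assms by (simp add: minus_L1.abs_eq norm_L1.abs_eq L1_eq_def)

lemma L1_class_lincomb:
  assumes "integrable unit_interval f" "integrable unit_interval g"
  shows "L1_class (\<lambda>t. a * f t + b * g t) = a *\<^sub>R L1_class f + b *\<^sub>R L1_class g"
  using assms by (simp add: scaleR_L1.abs_eq plus_L1.abs_eq L1_eq_def)

lemma norm_vec_le_sum: "norm (x :: 'a::real_normed_vector ^ 'n) \<le> (\<Sum>i\<in>UNIV. norm (x $ i))"
  unfolding norm_vec_def by (rule L2_set_le_sum) simp

text \<open>Averaging over the other coordinates contracts the L1 distance. The factor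
  \<open>CARD('n)\<close> comes from bounding the Euclidean norm of the tuple by the sum of its
  component norms.\<close>

lemma norm_marginals_diff:
  fixes f g :: "('n::finite \<Rightarrow> real) \<Rightarrow> real"
  assumes f: "unit_valued f" and g: "unit_valued g"
  shows "norm (marginals f - marginals g) \<le> CARD('n) * (\<integral>x. \<bar>f x - g x\<bar> \<partial>cube UNIV)"
proof -
  have m: "(\<lambda>x. \<bar>f x - g x\<bar>) \<in> borel_measurable (cube UNIV)"
    using f g by measurable
  have b: "\<bar>\<bar>f x - g x\<bar>\<bar> \<le> 2" if "x \<in> space (cube UNIV)" for x
    using unit_valued_bounds[OF f that] unit_valued_bounds[OF g that] by auto
  have "norm ((marginals f - marginals g) $ i) \<le> (\<integral>x. \<bar>f x - g x\<bar> \<partial>cube UNIV)" for i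
  proof -
    have "norm ((marginals f - marginals g) $ i) = (\<integral>t. \<bar>marginal f i t - marginal g i t\<bar> \<partial>unit_interval)"
      unfolding marginals_def using f g
      by (simp add: norm_L1_class_diff unit_valued_integrable_marginal)
    also have "\<dots> \<le> (\<integral>t. (\<integral>x. \<bar>f (x(i := t)) - g (x(i := t))\<bar> \<partial>cube (UNIV - {i})) \<partial>unit_interval)"
    proof (rule integral_mono)
      show "integrable unit_interval (\<lambda>t. \<bar>marginal f i t - marginal g i t\<bar>)"
        using f g by (simp add: unit_valued_integrable_marginal)
      show "integrable unit_interval (\<lambda>t. \<integral>x. \<bar>f (x(i := t)) - g (x(i := t))\<bar> \<partial>cube (UNIV - {i}))"
        by (rule cube_Fubini(1)[OF m b])
      fix t assume "t \<in> space unit_interval"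
      then have t: "t \<in> {0..1}" by simp
      show "\<bar>marginal f i t - marginal g i t\<bar>
          \<le> (\<integral>x. \<bar>f (x(i := t)) - g (x(i := t))\<bar> \<partial>cube (UNIV - {i}))"
        unfolding marginal_def
        by (simp flip: Bochner_Integration.integral_diff
              add: unit_valued_section_integrable[OF f t] unit_valued_section_integrable[OF g t])
    qed
    also have "\<dots> = (\<integral>x. \<bar>f x - g x\<bar> \<partial>cube UNIV)"
      by (rule cube_Fubini(2)[OF m b])
    finally show ?thesis .
  qed
  then have "(\<Sum>i\<in>UNIV. norm ((marginals f - marginals g) $ i)) \<le> (\<Sum>i\<in>(UNIV :: 'n set). \<integral>x. \<bar>f x - g x\<bar> \<partial>cube UNIV)"
    by (rule sum_mono)
  then show ?thesis
    using norm_vec_le_sum[of "marginals f - marginals g"] by simp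
qed

text \<open>Dominated convergence with bound 1 turns the a.e. limit into an L1 limit, to which
  \<open>norm_marginals_diff\<close> applies.\<close>

lemma tendsto_marginals_AE:
  fixes f :: "nat \<Rightarrow> ('n::finite \<Rightarrow> real) \<Rightarrow> real"
  assumes f: "\<And>k. unit_valued (f k)" and g: "unit_valued g"
    and lim: "AE x in cube UNIV. (\<lambda>k. f k x) \<longlonglongrightarrow> g x"
  shows "(\<lambda>k. marginals (f k)) \<longlonglongrightarrow> marginals g"
    and "(\<lambda>k. \<integral>x. f k x \<partial>cube UNIV) \<longlonglongrightarrow> (\<integral>x. g x \<partial>cube UNIV)"
proof -
  have "(\<lambda>k. \<integral>x. \<bar>f k x - g x\<bar> \<partial>cube UNIV) \<longlonglongrightarrow> (\<integral>x. (0::real) \<partial>cube (UNIV :: 'n set))"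
  proof (rule integral_dominated_convergence[where w = "\<lambda>_. 1"])
    show "AE x in cube UNIV. (\<lambda>k. \<bar>f k x - g x\<bar>) \<longlonglongrightarrow> 0"
      using lim by eventually_elim (use LIM_zero tendsto_rabs_zero in blast)
    show "AE x in cube UNIV. norm \<bar>f k x - g x\<bar> \<le> 1" for k
    proof (rule AE_I2)
      fix x :: "'n \<Rightarrow> real" assume "x \<in> space (cube UNIV)"
      from unit_valued_bounds[OF f this, of k] unit_valued_bounds[OF g this]
      show "norm \<bar>f k x - g x\<bar> \<le> 1" by auto
    qed
  qed (use f g in \<open>auto dest: unit_valued_measurable\<close>)
  then have *: "(\<lambda>k. \<integral>x. \<bar>f k x - g x\<bar> \<partial>cube UNIV) \<longlonglongrightarrow> 0" by simp
  have "(\<lambda>k. CARD('n) * (\<integral>x. \<bar>f k x - g x\<bar> \<partial>cube UNIV)) \<longlonglongrightarrow> 0"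
    using tendsto_mult_left[OF *, of "real CARD('n)"] by simp
  then have "(\<lambda>k. marginals (f k) - marginals g) \<longlonglongrightarrow> 0"
    by (rule Lim_null_comparison[rotated]) (use norm_marginals_diff[OF f g] in simp)
  then show "(\<lambda>k. marginals (f k)) \<longlonglongrightarrow> marginals g"
    by (rule LIM_zero_cancel)
  show "(\<lambda>k. \<integral>x. f k x \<partial>cube UNIV) \<longlonglongrightarrow> (\<integral>x. g x \<partial>cube UNIV)"
  proof (rule integral_dominated_convergence[where w = "\<lambda>_. 1"])
    show "AE x in cube UNIV. norm (f k x) \<le> 1" for k
      by (rule AE_I2) (use unit_valued_bounds[OF f] in auto)
  qed (use f g lim in \<open>auto dest: unit_valued_measurable\<close>)
qed

text \<open>The coefficients are arbitrary reals, not convex weights, so that weighted sums can be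
  built up one term at a time.\<close>

lemma marginals_lincomb:
  assumes f: "unit_valued f" and g: "unit_valued g"
    and fg: "unit_valued (\<lambda>x. a * f x + b * g x)"
  shows "marginals (\<lambda>x. a * f x + b * g x) = a *\<^sub>R marginals f + b *\<^sub>R marginals g"
proof -
  have "L1_class (marginal (\<lambda>x. a * f x + b * g x) i)
      = L1_class (\<lambda>t. a * marginal f i t + b * marginal g i t)" for i
  proof (subst L1_class_eq_iff)
    show "AE t in unit_interval. marginal (\<lambda>x. a * f x + b * g x) i t
        = a * marginal f i t + b * marginal g i t"
    proof (rule AE_I2)
      fix t assume "t \<in> space unit_interval"
      then have t: "t \<in> {0..1}" by simp
      show "marginal (\<lambda>x. a * f x + b * g x) i t = a * marginal f i t + b * marginal g i t"
        unfolding marginal_def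
        using unit_valued_section_integrable[OF f t, of i] unit_valued_section_integrable[OF g t, of i]
        by simp
    qed
  qed (use f g fg in \<open>auto simp: unit_valued_integrable_marginal\<close>)
  then show ?thesis
    using f g by (simp add: marginals_def vec_eq_iff L1_class_lincomb unit_valued_integrable_marginal)
qed

lemma unit_valued_convex_comb:
  assumes "unit_valued f" "unit_valued g" "0 \<le> a" "0 \<le> b" "a + b = 1"
  shows "unit_valued (\<lambda>x. a * f x + b * g x)"
  unfolding unit_valued_def
proof (intro conjI ballI)
  show "(\<lambda>x. a * f x + b * g x) \<in> borel_measurable (cube UNIV)"
    using assms(1,2)[THEN unit_valued_measurable] by measurable
  fix x :: "'a \<Rightarrow> real" assume x: "x \<in> space (cube UNIV)"
  show "a * f x + b * g x \<in> {0..1}"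
    using convex_bound_le[OF unit_valued_bounds(2)[OF assms(1) x] unit_valued_bounds(2)[OF assms(2) x] assms(3-5)]
      unit_valued_bounds(1)[OF assms(1) x] unit_valued_bounds(1)[OF assms(2) x] assms(3,4) by simp
qed

section \<open>Signals that are monotone off a null set\<close>

text \<open>One null set of points is removed, instead of a null set of pairs. Countably many such
  sets can then be merged in a limit, and the remaining points generate honest up-sets.\<close>

definition ae_mono :: "(('n::finite \<Rightarrow> real) \<Rightarrow> real) \<Rightarrow> bool" where
  "ae_mono f \<longleftrightarrow> (\<exists>N\<in>null_sets (cube UNIV).
     \<forall>x\<in>space (cube UNIV) - N. \<forall>y\<in>space (cube UNIV) - N. x \<le> y \<longrightarrow> f x \<le> f y)"

definition mono_signals :: "real \<Rightarrow> (('n::finite \<Rightarrow> real) \<Rightarrow> real) set" where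
  "mono_signals p = {f \<in> signals p. ae_mono f}"

lemma ae_mono_lincomb:
  assumes "ae_mono f" "ae_mono g" "0 \<le> a" "0 \<le> b"
  shows "ae_mono (\<lambda>x. a * f x + b * g x)"
proof -
  obtain N where N: "N \<in> null_sets (cube UNIV)"
    "\<And>x y. x \<in> space (cube UNIV) - N \<Longrightarrow> y \<in> space (cube UNIV) - N \<Longrightarrow> x \<le> y \<Longrightarrow> f x \<le> f y"
    using assms(1) unfolding ae_mono_def by blast
  obtain N' where N': "N' \<in> null_sets (cube UNIV)"
    "\<And>x y. x \<in> space (cube UNIV) - N' \<Longrightarrow> y \<in> space (cube UNIV) - N' \<Longrightarrow> x \<le> y \<Longrightarrow> g x \<le> g y"
    using assms(2) unfolding ae_mono_def by blast
  show ?thesis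
    unfolding ae_mono_def
    by (rule bexI[of _ "N \<union> N'"])
       (use N N' assms(3,4) in \<open>auto intro!: add_mono mult_left_mono\<close>)
qed

text \<open>The exceptional set of the limit is the union of those of the sequence and of a null set
  containing all points without convergence.\<close>

lemma ae_mono_AE_limit:
  fixes f :: "nat \<Rightarrow> ('n::finite \<Rightarrow> real) \<Rightarrow> real"
  assumes "\<And>k. ae_mono (f k)" and lim: "AE x in cube UNIV. (\<lambda>k. f k x) \<longlonglongrightarrow> g x"
  shows "ae_mono g"
proof -
  have "\<forall>k. \<exists>N\<in>null_sets (cube UNIV). \<forall>x\<in>space (cube UNIV) - N. \<forall>y\<in>space (cube UNIV) - N.
      x \<le> y \<longrightarrow> f k x \<le> f k y"
    using assms(1) unfolding ae_mono_def by blast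
  then obtain N where N: "\<And>k. N k \<in> null_sets (cube UNIV)"
    "\<And>k x y. x \<in> space (cube UNIV) - N k \<Longrightarrow> y \<in> space (cube UNIV) - N k \<Longrightarrow> x \<le> y \<Longrightarrow> f k x \<le> f k y"
    by metis
  obtain N' where N': "{x \<in> space (cube UNIV). \<not> (\<lambda>k. f k x) \<longlonglongrightarrow> g x} \<subseteq> N'" "N' \<in> null_sets (cube UNIV)"
    using lim by (auto elim!: AE_E simp: null_sets_def)
  let ?N = "N' \<union> (\<Union>k. N k)"
  have "g x \<le> g y" if "x \<in> space (cube UNIV) - ?N" "y \<in> space (cube UNIV) - ?N" "x \<le> y" for x y
    by (rule LIMSEQ_le[of "\<lambda>k. f k x" _ "\<lambda>k. f k y"]) (use that N(2) N'(1) in auto)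
  then show ?thesis
    unfolding ae_mono_def by (intro bexI[of _ ?N]) (use N(1) N'(2) in \<open>auto intro!: null_sets.Un null_sets_UN\<close>)
qed

lemma mono_signals_convex_comb:
  assumes f: "f \<in> mono_signals p" and g: "g \<in> mono_signals p" and ab: "0 \<le> a" "0 \<le> b" "a + b = 1"
  shows "(\<lambda>x. a * f x + b * g x) \<in> mono_signals p"
    and "marginals (\<lambda>x. a * f x + b * g x) = a *\<^sub>R marginals f + b *\<^sub>R marginals g"
proof -
  have fg: "unit_valued f" "unit_valued g" "(\<integral>x. f x \<partial>cube UNIV) = p" "(\<integral>x. g x \<partial>cube UNIV) = p"
    using f g by (auto simp: mono_signals_def signals_eq)
  have "a * p + b * p = p" using ab(3) by (metis distrib_right mult_1)
  then show "(\<lambda>x. a * f x + b * g x) \<in> mono_signals p"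
    using fg ab f g unit_valued_convex_comb[OF fg(1,2) ab]
    by (auto simp: mono_signals_def signals_eq unit_valued_integrable intro!: ae_mono_lincomb)
  show "marginals (\<lambda>x. a * f x + b * g x) = a *\<^sub>R marginals f + b *\<^sub>R marginals g"
    by (rule marginals_lincomb) (use fg ab unit_valued_convex_comb[OF fg(1,2) ab] in auto)
qed

section \<open>Compactness: the marginals of monotone signals form a closed convex set\<close>

lemma unit_valued_square_integrable:
  assumes "unit_valued f"
  shows "integrable (cube UNIV) (\<lambda>x. (f x)\<^sup>2)"
  by (rule integrable_cube_bounded[where B = 1])
     (use assms unit_valued_bounds[OF assms] unit_valued_measurable[OF assms] in \<open>auto simp: power_le_one\<close>)

lemma L2_parallelogram:
  assumes f: "unit_valued f" and g: "unit_valued g"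
  shows "(\<integral>x. (f x - g x)\<^sup>2 \<partial>cube UNIV) = 2 * (\<integral>x. (f x)\<^sup>2 \<partial>cube UNIV) + 2 * (\<integral>x. (g x)\<^sup>2 \<partial>cube UNIV)
    - 4 * (\<integral>x. (1/2 * f x + 1/2 * g x)\<^sup>2 \<partial>cube UNIV)"
proof -
  have fg: "unit_valued (\<lambda>x. 1/2 * f x + 1/2 * g x)"
    by (rule unit_valued_convex_comb) (use f g in auto)
  have "(\<integral>x. (f x - g x)\<^sup>2 \<partial>cube UNIV)
      = (\<integral>x. 2 * (f x)\<^sup>2 + 2 * (g x)\<^sup>2 - 4 * (1/2 * f x + 1/2 * g x)\<^sup>2 \<partial>cube UNIV)"
    by (intro Bochner_Integration.integral_cong) (auto simp: power2_eq_square algebra_simps)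
  then show ?thesis
    using unit_valued_square_integrable[OF f] unit_valued_square_integrable[OF g]
      unit_valued_square_integrable[OF fg] by simp
qed

text \<open>In place of Cauchy-Schwarz, integrate
  \<open>\<bar>d\<bar> \<le> d\<^sup>2 / (2 * e) + e / 2\<close>, which is
  \<open>0 \<le> (\<bar>d\<bar> - e)\<^sup>2\<close> rearranged.\<close>

lemma L1_less_if_L2_less:
  assumes f: "unit_valued f" and g: "unit_valued g" and e: "0 < e"
    and less: "(\<integral>x. (f x - g x)\<^sup>2 \<partial>cube UNIV) < e\<^sup>2"
  shows "(\<integral>x. \<bar>f x - g x\<bar> \<partial>cube UNIV) < e"
proof -
  have b: "\<bar>f x - g x\<bar> \<le> 1" if "x \<in> space (cube UNIV)" for x
    using unit_valued_bounds[OF f that] unit_valued_bounds[OF g that] by auto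
  have int2: "integrable (cube UNIV) (\<lambda>x. (f x - g x)\<^sup>2)"
    by (rule integrable_cube_bounded[where B = 1])
       (use b f g in \<open>auto dest!: unit_valued_measurable simp: abs_square_le_1\<close>)
  have "(\<integral>x. \<bar>f x - g x\<bar> \<partial>cube UNIV) \<le> (\<integral>x. (f x - g x)\<^sup>2 / (2 * e) + e / 2 \<partial>cube UNIV)"
  proof (rule integral_mono)
    show "integrable (cube UNIV) (\<lambda>x. \<bar>f x - g x\<bar>)"
      using f g by (simp add: unit_valued_integrable)
    fix x
    have "0 \<le> (\<bar>f x - g x\<bar> - e)\<^sup>2" by simp
    then show "\<bar>f x - g x\<bar> \<le> (f x - g x)\<^sup>2 / (2 * e) + e / 2"
      using e by (simp add: field_simps power2_eq_square flip: abs_mult)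
  qed (use int2 in simp)
  also have "\<dots> = (\<integral>x. (f x - g x)\<^sup>2 \<partial>cube UNIV) / (2 * e) + e / 2"
    using int2 by (simp add: cube.prob_space)
  also have "\<dots> < e\<^sup>2 / (2 * e) + e / 2"
    using less e by (simp add: divide_strict_right_mono)
  also have "\<dots> = e" using e by (simp add: field_simps power2_eq_square)
  finally show ?thesis .
qed

text \<open>The expression is what the parallelogram law leaves as a bound on the squared distance
  of two signals whose energies exceed the infima \<open>I k\<close> and \<open>I j\<close> by at
  most \<open>1 / Suc k\<close>, while their midpoint has energy at least \<open>I k\<close>. It is
  small because a bounded increasing sequence is Cauchy.\<close>

lemma cauchy_if_nearly_minimal:
  fixes I :: "nat \<Rightarrow> real"
  assumes "incseq I" "\<And>k. I k \<le> B" and "0 < e"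
  shows "\<exists>N. \<forall>k\<ge>N. \<forall>j\<ge>k. 2 * (I j - I k) + 4 / Suc k < e"
proof -
  have "convergent I"
    using incseq_convergent[OF assms(1)] assms(2) by (metis convergent_def)
  then have "Cauchy I" by (rule convergent_Cauchy)
  then obtain N where N: "\<And>m n. m \<ge> N \<Longrightarrow> n \<ge> N \<Longrightarrow> \<bar>I m - I n\<bar> < e / 4"
    using assms(3) unfolding Cauchy_def dist_real_def by (metis zero_less_divide_iff zero_less_numeral)
  obtain N' where N': "8 / e < real N'" using reals_Archimedean2 by blast
  have "2 * (I j - I k) + 4 / Suc k < e" if "k \<ge> max N N'" "j \<ge> k" for k j
  proof -
    have "8 / e < real (Suc k)" using N' that by simp
    then have "4 / Suc k < e / 2" using assms(3) by (simp add: field_simps)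
    moreover have "I j - I k < e / 4" using N[of j k] abs_ge_self[of "I j - I k"] that by simp
    then have "2 * (I j - I k) < e / 2" by (simp add: field_simps)
    ultimately show ?thesis by (metis add_strict_mono field_sum_of_halves add.commute)
  qed
  then show ?thesis by blast
qed

text \<open>
  Signals of nearly minimal \<open>L\<^sup>2\<close> norm, among those whose marginals are within \<open>1 / Suc k\<close> of the
  limit, form an \<open>L\<^sup>2\<close>-Cauchy sequence by the parallelogram law; this replaces weak compactness.
\<close>

lemma closed_marginals_mono_signals: "closed (marginals ` mono_signals p)"
proof -
  have "q \<in> marginals ` mono_signals p" if q: "q \<in> closure (marginals ` mono_signals p)"
    for q :: "L1 ^ 'n::finite"
  proof -
    define C where "C k = {g \<in> mono_signals p. marginals g \<in> ball q (1 / Suc k)}" for k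
    define E where "E g = (\<integral>x. (g x)\<^sup>2 \<partial>cube (UNIV :: 'n set))" for g :: "('n \<Rightarrow> real) \<Rightarrow> real"
    define I where "I k = Inf (E ` C k)" for k
    have uv: "unit_valued g" if "g \<in> C k" for g k
      using that by (simp add: C_def mono_signals_def signals_eq)
    have E0: "0 \<le> E g" for g by (simp add: E_def)
    have bdd: "bdd_below (E ` C k)" for k by (rule bdd_belowI[of _ 0]) (use E0 in auto)
    have ne: "C k \<noteq> {}" for k
    proof -
      obtain y where "y \<in> marginals ` mono_signals p" "dist y q < 1 / Suc k"
        using q unfolding closure_approachable by (metis of_nat_0_less_iff zero_less_Suc zero_less_divide_1_iff)
      then show ?thesis by (auto simp: C_def dist_commute)
    qed
    have C_mono: "C j \<subseteq> C k" if "k \<le> j" for j k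
    proof -
      have "1 / Suc j \<le> 1 / Suc k" using that by (simp add: frac_le)
      then show ?thesis by (auto simp: C_def)
    qed
    have "\<exists>g\<in>C k. E g < I k + 1 / Suc k" for k
      using cInf_lessD[of "E ` C k" "I k + 1 / Suc k"] ne[of k] by (auto simp: I_def)
    then obtain g where g: "\<And>k. g k \<in> C k" "\<And>k. E (g k) < I k + 1 / Suc k" by metis
    have I_le: "I k \<le> E h" if "h \<in> C k" for h k
      unfolding I_def by (rule cInf_lower) (use that bdd in auto)
    \<comment> \<open>The sets \<open>C k\<close> shrink, so their infima grow.\<close>
    have inc: "incseq I"
      unfolding I_def
      by (rule incseq_SucI, rule cInf_superset_mono[OF _ bdd image_mono[OF C_mono]]) (simp_all add: ne)
    have "I k \<le> 1" for k
    proof -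
      have "E (g k) \<le> 1"
        unfolding E_def
        by (rule cube.integral_le_const[OF unit_valued_square_integrable[OF uv[OF g(1)]]])
           (use unit_valued_bounds[OF uv[OF g(1)]] in \<open>auto intro!: AE_I2 power_le_one\<close>)
      then show ?thesis using I_le[OF g(1)] order_trans by blast
    qed
    note cauchy = cauchy_if_nearly_minimal[OF inc this]
    have L2: "(\<integral>x. (g k x - g j x)\<^sup>2 \<partial>cube UNIV) \<le> 2 * (I j - I k) + 4 / Suc k" if "k \<le> j" for k j
    proof -
      have gk: "g k \<in> C k" "g j \<in> C k" using g(1) C_mono[OF that] by auto
      \<comment> \<open>The midpoint competes for the infimum \<open>I k\<close>: its marginals are
        the midpoint of two points of the ball around \<open>q\<close>, and balls are
        convex.\<close>
      have "(\<lambda>x. 1/2 * g k x + 1/2 * g j x) \<in> C k"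
        using gk mono_signals_convex_comb[of "g k" p "g j" "1/2" "1/2"]
          convexD[OF convex_ball, of "marginals (g k)" q "1 / Suc k" "marginals (g j)" "1/2" "1/2"]
        by (auto simp: C_def)
      then have "I k \<le> E (\<lambda>x. 1/2 * g k x + 1/2 * g j x)" by (rule I_le)
      moreover have "1 / Suc j \<le> 1 / Suc k" using that by (simp add: frac_le)
      moreover have "4 / Suc k = 4 * (1 / Suc k)" by simp
      ultimately show ?thesis
        using L2_parallelogram[OF uv[OF gk(1)] uv[OF gk(2)]] g(2)[of k] g(2)[of j]
        unfolding E_def right_diff_distrib by linarith
    qed
    obtain r where r: "strict_mono r" "AE x in cube UNIV. Cauchy (\<lambda>i. g (r i) x)"
    proof (rule cauchy_L1_AE_cauchy_subseq[of "cube UNIV" g])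
      show "integrable (cube UNIV) (g k)" for k by (rule unit_valued_integrable[OF uv[OF g(1)]])
      fix e :: real assume e: "0 < e"
      then obtain N where N: "\<And>k j. N \<le> k \<Longrightarrow> k \<le> j \<Longrightarrow> 2 * (I j - I k) + 4 / Suc k < e\<^sup>2"
        using cauchy[of "e\<^sup>2"] by auto
      have *: "(\<integral>x. \<bar>g k x - g j x\<bar> \<partial>cube UNIV) < e" if "N \<le> k" "k \<le> j" for k j
        by (rule L1_less_if_L2_less[OF uv[OF g(1)] uv[OF g(1)] e])
           (use L2[OF that(2)] N[OF that] in linarith)
      have "(\<integral>x. norm (g k x - g j x) \<partial>cube UNIV) < e" if "N \<le> k" "N \<le> j" for k j
        using *[of k j] *[of j k] that by (cases "k \<le> j") (auto simp: abs_minus_commute)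
      then show "\<exists>N. \<forall>k\<ge>N. \<forall>j\<ge>N. (\<integral>x. norm (g k x - g j x) \<partial>cube UNIV) < e" by blast
    qed
    \<comment> \<open>Where the sequence fails to converge, \<open>lim\<close> is an arbitrary
      value; clipping keeps \<open>h\<close> in [0,1] everywhere.\<close>
    define h where "h x = min 1 (max 0 (lim (\<lambda>i. g (r i) x)))" for x
    have h: "unit_valued h"
    proof -
      have [measurable]: "g k \<in> borel_measurable (cube UNIV)" for k
        by (rule unit_valued_measurable[OF uv[OF g(1)]])
      have "h \<in> borel_measurable (cube UNIV)" unfolding h_def by measurable
      then show ?thesis by (auto simp: unit_valued_def h_def)
    qed
    have lim: "AE x in cube UNIV. (\<lambda>i. g (r i) x) \<longlonglongrightarrow> h x"
      using r(2) AE_space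
    proof eventually_elim
      case (elim x)
      then have *: "(\<lambda>i. g (r i) x) \<longlonglongrightarrow> lim (\<lambda>i. g (r i) x)"
        by (simp add: Cauchy_convergent_iff convergent_LIMSEQ_iff)
      have "0 \<le> lim (\<lambda>i. g (r i) x)" "lim (\<lambda>i. g (r i) x) \<le> 1"
        using LIMSEQ_le_const[OF *] LIMSEQ_le_const2[OF *] unit_valued_bounds[OF uv[OF g(1)] elim(2)] by blast+
      then show ?case using * by (simp add: h_def)
    qed
    note conv = tendsto_marginals_AE[of "\<lambda>i. g (r i)", OF uv[OF g(1)] h lim]
    have "(\<lambda>k. dist (marginals (g k)) q) \<longlonglongrightarrow> 0"
      by (rule Lim_null_comparison[OF _ LIMSEQ_inverse_real_of_nat])
         (use g(1) in \<open>auto simp: C_def dist_commute inverse_eq_divide less_imp_le\<close>)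
    then have "(\<lambda>i. marginals (g (r i))) \<longlonglongrightarrow> q"
      using LIMSEQ_subseq_LIMSEQ[OF _ r(1)] tendsto_dist_iff by (fastforce simp: o_def)
    with conv(1) have "marginals h = q" by (rule LIMSEQ_unique)
    moreover have "h \<in> mono_signals p"
    proof -
      have gm: "g k \<in> mono_signals p" for k using g(1) by (auto simp: C_def)
      then have "(\<integral>x. h x \<partial>cube UNIV) = p"
        using conv(2) by (simp add: mono_signals_def signals_eq LIMSEQ_const_iff)
      moreover have "ae_mono h"
        by (rule ae_mono_AE_limit[OF _ lim]) (use gm in \<open>simp add: mono_signals_def\<close>)
      ultimately show ?thesis using h by (simp add: mono_signals_def signals_eq)
    qed
    ultimately show ?thesis by blast
  qed
  then show ?thesis using closure_subset_eq by blast
qed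

lemma convex_marginals_mono_signals: "convex (marginals ` mono_signals p)"
proof (rule convexI)
  fix x y :: "L1 ^ 'n::finite" and u v :: real
  assume "x \<in> marginals ` mono_signals p" "y \<in> marginals ` mono_signals p" "0 \<le> u" "0 \<le> v" "u + v = 1"
  then show "u *\<^sub>R x + v *\<^sub>R y \<in> marginals ` mono_signals p"
    using mono_signals_convex_comb by (smt (verit) imageE image_eqI)
qed

lemma nested_bi_upset_signals_subset: "nested_bi_upset_signals p \<subseteq> mono_signals p"
proof
  fix f :: "('n::finite \<Rightarrow> real) \<Rightarrow> real" assume "f \<in> nested_bi_upset_signals p"
  then obtain A1 A2 c where f: "f \<in> signals p" and A: "up_set A1" "up_set A2" "A1 \<subseteq> A2" "c \<in> {0..1}"
    and eq: "AE x in cube UNIV. f x = indicator A1 x + c * indicator (A2 - A1) x"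
    by (auto simp: nested_bi_upset_signals_def)
  obtain N where N: "{x \<in> space (cube UNIV). f x \<noteq> indicator A1 x + c * indicator (A2 - A1) x} \<subseteq> N"
      "N \<in> null_sets (cube UNIV)"
    using eq by (auto elim!: AE_E simp: null_sets_def)
  have "f x \<le> f y" if "x \<in> space (cube UNIV) - N" "y \<in> space (cube UNIV) - N" "x \<le> y" for x y
  proof -
    have "f x = indicator A1 x + c * indicator (A2 - A1) x" "f y = indicator A1 y + c * indicator (A2 - A1) y"
      using N(1) that by auto
    moreover have "x \<in> A1 \<Longrightarrow> y \<in> A1" "x \<in> A2 \<Longrightarrow> y \<in> A2"
      using A that by (auto simp: up_set_def)
    ultimately show ?thesis using A(3,4) by (auto simp: indicator_def)
  qed
  then show "f \<in> mono_signals p"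
    using f N(2) by (auto simp: mono_signals_def ae_mono_def)
qed

lemma Q_star_eq: "Q_star p = marginals ` nested_bi_upset_signals p"
  by (auto simp: Q_star_def marginals_def)

lemma closure_hull_Q_star_subset: "closure (convex hull (Q_star p)) \<subseteq> marginals ` mono_signals p"
  by (intro closure_minimal hull_minimal closed_marginals_mono_signals convex_marginals_mono_signals)
     (use nested_bi_upset_signals_subset in \<open>auto simp: Q_star_eq\<close>)

section \<open>Monotone signals lie in the closed convex hull\<close>

text \<open>Every index with \<open>v\<close> below \<open>p\<close> is paired with every index
  above \<open>p\<close>, in the proportion that gives the pair mean \<open>p\<close>. The shortfall
  below \<open>p\<close> equals the excess above it (both are \<open>D\<close>), which allows the
  pair weights to be chosen so that each index recovers its weight \<open>w\<close>. Indices with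
  \<open>v j = p\<close> stay alone.\<close>

lemma two_point_decomposition:
  fixes x :: "'i \<Rightarrow> 'v::real_vector" and v w :: "'i \<Rightarrow> real"
  assumes J: "finite J" and w: "\<And>j. j \<in> J \<Longrightarrow> 0 \<le> w j" "sum w J = 1"
    and mean: "(\<Sum>j\<in>J. w j * v j) = p" and C: "convex C"
    and pair: "\<And>i k l. i \<in> J \<Longrightarrow> k \<in> J \<Longrightarrow> 0 \<le> l \<Longrightarrow> l \<le> 1 \<Longrightarrow> l * v i + (1 - l) * v k = p
      \<Longrightarrow> l *\<^sub>R x i + (1 - l) *\<^sub>R x k \<in> C"
  shows "(\<Sum>j\<in>J. w j *\<^sub>R x j) \<in> C"
proof -
  define M P Z where "M = {j\<in>J. v j < p}" and "P = {j\<in>J. p < v j}" and "Z = {j\<in>J. v j = p}"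
  have fin: "finite M" "finite P" "finite Z" using J by (auto simp: M_def P_def Z_def)
  have split: "sum h J = sum h Z + (sum h M + sum h P)" for h :: "'i \<Rightarrow> 'b::comm_monoid_add"
  proof -
    have "J = Z \<union> (M \<union> P)" by (auto simp: M_def P_def Z_def)
    moreover have "Z \<inter> (M \<union> P) = {}" "M \<inter> P = {}" by (auto simp: M_def P_def Z_def)
    ultimately show ?thesis using fin by (metis finite_UnI sum.union_disjoint)
  qed
  have Z: "x j \<in> C" if "j \<in> Z" for j using pair[of j j 1] that by (simp add: Z_def)
  define D where "D = (\<Sum>k\<in>P. w k * (v k - p))"
  have "(\<Sum>j\<in>J. w j * (v j - p)) = 0"
    using mean w(2) by (simp add: right_diff_distrib sum_subtractf flip: sum_distrib_right)
  moreover have "(\<Sum>j\<in>Z. w j * (v j - p)) = 0" by (simp add: Z_def)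
  ultimately have D': "D = (\<Sum>i\<in>M. w i * (p - v i))"
    unfolding split D_def by (simp add: right_diff_distrib sum_subtractf)
  show ?thesis
  \<comment> \<open>Without excess all the weight sits on \<open>Z\<close>, and dividing by
    \<open>D\<close> would make no sense.\<close>
  proof (cases "D = 0")
    case True
    have "\<forall>k\<in>P. w k * (v k - p) = 0"
      using True w(1) fin(2) unfolding D_def
      by (subst (asm) sum_nonneg_eq_0_iff) (auto simp: P_def)
    then have P0: "w k = 0" if "k \<in> P" for k using that by (auto simp: P_def)
    have "\<forall>k\<in>M. w k * (p - v k) = 0"
      using True w(1) fin(1) unfolding D'
      by (subst (asm) sum_nonneg_eq_0_iff) (auto simp: M_def)
    then have M0: "w k = 0" if "k \<in> M" for k using that by (auto simp: M_def)
    have "sum w Z = 1" using w(2) M0 P0 unfolding split by simp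
    then have "(\<Sum>j\<in>Z. w j *\<^sub>R x j) \<in> C"
      by (intro convex_sum C fin Z w) (auto simp: Z_def)
    then show ?thesis unfolding split using M0 P0 by simp
  next
    case False
    moreover have "0 \<le> D" unfolding D_def by (rule sum_nonneg) (use w(1) in \<open>auto simp: P_def\<close>)
    ultimately have D: "0 < D" by simp
    \<comment> \<open>Product coupling of shortfall and excess: index \<open>i\<close> contributes
      \<open>w i * w k * (v k - p) / D\<close> to the pair, index \<open>k\<close> contributes
      \<open>w i * w k * (p - v i) / D\<close>, and \<open>W i k\<close> is the total. Summing the
      first over \<open>k\<close>, or the second over \<open>i\<close>, returns \<open>w i\<close>
      or \<open>w k\<close>.\<close>
    define W where "W i k = w i * w k * (v k - v i) / D" for i k
    define y where "y i k = ((v k - p) / (v k - v i)) *\<^sub>R x i + ((p - v i) / (v k - v i)) *\<^sub>R x k" for i k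
    have y: "y i k \<in> C" if "i \<in> M" "k \<in> P" for i k
    proof -
      have less: "v i < p" "p < v k" "i \<in> J" "k \<in> J" using that by (auto simp: M_def P_def)
      have *: "1 - (v k - p) / (v k - v i) = (p - v i) / (v k - v i)"
        using less by (simp add: field_simps)
      have "(v k - p) / (v k - v i) * v i + (1 - (v k - p) / (v k - v i)) * v k = p"
        unfolding * using less by (simp add: divide_simps) (simp add: algebra_simps)
      from pair[OF less(3,4) _ _ this] show ?thesis
        using less unfolding * y_def by (simp add: divide_simps)
    qed
    have W0: "0 \<le> W i k" if "i \<in> M" "k \<in> P" for i k
      using that w(1) D by (auto simp: W_def M_def P_def)
    \<comment> \<open>The vectors \<open>z\<close> are general because the identity is used twice:
      with the constant 1 for the total weight, and with \<open>x\<close> for the weighted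
      sum.\<close>
    have pairsum: "(\<Sum>(i, k)\<in>M \<times> P. (w i * w k * (v k - p) / D) *\<^sub>R z i + (w i * w k * (p - v i) / D) *\<^sub>R z k)
        = (\<Sum>i\<in>M. w i *\<^sub>R z i) + (\<Sum>k\<in>P. w k *\<^sub>R z k)" for z :: "'i \<Rightarrow> 'u::real_vector"
    proof -
      have "(\<Sum>k\<in>P. w i * w k * (v k - p) / D) = w i * (D / D)" for i
        unfolding D_def sum_divide_distrib sum_distrib_left by (simp add: mult.assoc)
      then have 1: "(\<Sum>k\<in>P. w i * w k * (v k - p) / D) = w i" for i using D by simp
      have "(\<Sum>i\<in>M. w i * w k * (p - v i) / D) = w k * (D / D)" for k
        unfolding D' sum_divide_distrib sum_distrib_left by (intro sum.cong) (auto simp: mult_ac)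
      then have 2: "(\<Sum>i\<in>M. w i * w k * (p - v i) / D) = w k" for k using D by simp
      show ?thesis
        unfolding sum.cartesian_product[symmetric] sum.distrib
        by (subst (2) sum.swap) (simp add: scaleR_left.sum[symmetric] 1 2)
    qed
    have Wy: "W i k *\<^sub>R y i k = (w i * w k * (v k - p) / D) *\<^sub>R x i + (w i * w k * (p - v i) / D) *\<^sub>R x k"
      if "i \<in> M" "k \<in> P" for i k
      using that unfolding W_def y_def scaleR_add_right scaleR_scaleR by (auto simp: M_def P_def mult.assoc)
    have W1: "W i k = (w i * w k * (v k - p) / D) *\<^sub>R 1 + (w i * w k * (p - v i) / D) *\<^sub>R 1" for i k
      using D unfolding W_def by (simp add: field_simps)
    \<comment> \<open>The convex combination runs over a disjoint sum: single points from
      \<open>Z\<close> and pairs from \<open>M \<times> P\<close>.\<close>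
    define c where "c = case_sum w (\<lambda>(i, k). W i k)"
    define t where "t = case_sum x (\<lambda>(i, k). y i k)"
    have "(\<Sum>a\<in>Z <+> M \<times> P. c a *\<^sub>R t a) \<in> C"
    proof (rule convex_sum[OF _ C])
      have "sum c (Z <+> M \<times> P) = sum w Z + (\<Sum>(i, k)\<in>M \<times> P. W i k)"
        using fin by (simp add: sum.Plus c_def o_def)
      also have "\<dots> = 1"
        unfolding W1 pairsum using w(2) unfolding split by simp
      finally show "sum c (Z <+> M \<times> P) = 1" .
    qed (use fin W0 w(1) y Z in \<open>auto simp: c_def t_def Z_def\<close>)
    also have "(\<Sum>a\<in>Z <+> M \<times> P. c a *\<^sub>R t a) = (\<Sum>j\<in>Z. w j *\<^sub>R x j) + (\<Sum>(i, k)\<in>M \<times> P. W i k *\<^sub>R y i k)"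
      using fin by (simp add: sum.Plus c_def t_def o_def split_beta')
    also have "(\<Sum>(i, k)\<in>M \<times> P. W i k *\<^sub>R y i k) = (\<Sum>(i, k)\<in>M \<times> P.
        (w i * w k * (v k - p) / D) *\<^sub>R x i + (w i * w k * (p - v i) / D) *\<^sub>R x k)"
      by (intro sum.cong refl) (use Wy in auto)
    also have "(\<Sum>j\<in>Z. w j *\<^sub>R x j) + \<dots> = (\<Sum>j\<in>J. w j *\<^sub>R x j)"
      unfolding pairsum split by simp
    finally show ?thesis .
  qed
qed

text \<open>Total weight at most 1, not equal to 1, is what survives the removal of one term in the
  induction.\<close>

lemma marginals_weighted_sum:
  assumes "finite J" "\<And>j. j \<in> J \<Longrightarrow> unit_valued (f j)" "\<And>j. j \<in> J \<Longrightarrow> 0 \<le> w j" "sum w J \<le> 1"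
  shows "unit_valued (\<lambda>x. \<Sum>j\<in>J. w j * f j x)
    \<and> marginals (\<lambda>x. \<Sum>j\<in>J. w j * f j x) = (\<Sum>j\<in>J. w j *\<^sub>R marginals (f j))"
  using assms
proof (induction J)
  case empty
  have "unit_valued (\<lambda>x :: 'b \<Rightarrow> real. 0)" by (simp add: unit_valued_def)
  from marginals_lincomb[OF this this, of 0 0] this show ?case by simp
next
  case (insert a J)
  have le: "sum w J \<le> 1" using insert by (smt (verit) insert_iff sum.insert)
  let ?g = "\<lambda>x. \<Sum>j\<in>J. w j * f j x"
  have IH: "unit_valued ?g" "marginals ?g = (\<Sum>j\<in>J. w j *\<^sub>R marginals (f j))"
    using insert le by auto
  have fa: "unit_valued (f a)" using insert by simp
  have "unit_valued (\<lambda>x. w a * f a x + 1 * ?g x)"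
    unfolding unit_valued_def
  proof (intro conjI ballI)
    show "(\<lambda>x. w a * f a x + 1 * ?g x) \<in> borel_measurable (cube UNIV)"
      using fa[THEN unit_valued_measurable] IH(1)[THEN unit_valued_measurable] by measurable
    fix x :: "'b \<Rightarrow> real" assume x: "x \<in> space (cube UNIV)"
    have "w a * f a x + 1 * ?g x = (\<Sum>j\<in>insert a J. w j * f j x)"
      using insert by simp
    moreover have "\<dots> \<le> (\<Sum>j\<in>insert a J. w j * 1)"
      using insert.prems unit_valued_bounds(2)[OF _ x] by (intro sum_mono mult_left_mono) auto
    moreover have "0 \<le> (\<Sum>j\<in>insert a J. w j * f j x)"
      using insert.prems unit_valued_bounds(1)[OF _ x] by (intro sum_nonneg mult_nonneg_nonneg) auto
    ultimately show "w a * f a x + 1 * ?g x \<in> {0..1}" using insert.prems(3) by simp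
  qed
  from marginals_lincomb[OF fa IH(1) this] this IH(2) show ?case
    using insert.hyps by simp
qed

text \<open>A level set of an a.e. monotone \<open>f\<close> need not be an up-set. Its points
  outside the null set \<open>N\<close> are closed upwards in the cube instead; monotonicity off
  \<open>N\<close> shows that this adds no further point outside \<open>N\<close>.\<close>

lemma nested_bi_upset_signals_threshold:
  fixes f :: "('n::finite \<Rightarrow> real) \<Rightarrow> real"
  assumes f: "ae_mono f" and g: "g \<in> signals p"
    and P: "\<And>s. P1 s \<Longrightarrow> P2 s" "\<And>s t. s \<le> t \<Longrightarrow> P1 s \<Longrightarrow> P1 t" "\<And>s t. s \<le> t \<Longrightarrow> P2 s \<Longrightarrow> P2 t"
    and c: "0 \<le> c" "c \<le> 1"
    and gf: "\<And>x. x \<in> space (cube UNIV) \<Longrightarrow> g x = (if P1 (f x) then 1 else if P2 (f x) then c else 0)"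
  shows "g \<in> nested_bi_upset_signals p"
proof -
  obtain N where N: "N \<in> null_sets (cube UNIV)"
    "\<And>x y. x \<in> space (cube UNIV) - N \<Longrightarrow> y \<in> space (cube UNIV) - N \<Longrightarrow> x \<le> y \<Longrightarrow> f x \<le> f y"
    using f unfolding ae_mono_def by blast
  define U where "U P = {y \<in> space (cube UNIV). \<exists>x\<in>space (cube UNIV) - N. P (f x) \<and> x \<le> y}" for P
  have up: "up_set (U P)" for P
    unfolding up_set_def U_def by (auto intro: order_trans)
  have "U P1 \<subseteq> U P2" using P(1) by (auto simp: U_def)
  moreover have "AE x in cube UNIV. g x = indicator (U P1) x + c * indicator (U P2 - U P1) x"
    using AE_not_in[OF N(1)] AE_space
  proof eventually_elim
    case (elim y)
    have "y \<in> U P \<longleftrightarrow> P (f y)" if "\<And>s t. s \<le> t \<Longrightarrow> P s \<Longrightarrow> P t" for P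
      using elim N(2) that unfolding U_def by auto
    then show ?case using P gf[OF elim(2)] by (auto simp: indicator_def)
  qed
  ultimately show ?thesis
    using g up c unfolding nested_bi_upset_signals_def by auto
qed

text \<open>The two level sets are nested, whichever threshold is the lower one. On their difference
  the mixture equals the weight of the lower threshold, which becomes the constant of the nested
  bi-upset signal.\<close>

lemma level_pair_nested_bi_upset:
  fixes f :: "('n::finite \<Rightarrow> real) \<Rightarrow> real"
  assumes f: "unit_valued f" "ae_mono f" and l: "0 \<le> l" "l \<le> 1"
    and g: "g = (\<lambda>x. l * of_bool (s < f x) + (1 - l) * of_bool (t < f x))"
    and p: "(\<integral>x. g x \<partial>cube UNIV) = p"
  shows "g \<in> nested_bi_upset_signals p"
proof -
  have [measurable]: "f \<in> borel_measurable (cube UNIV)" by (rule unit_valued_measurable[OF f(1)])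
  have "g \<in> borel_measurable (cube UNIV)" unfolding g by measurable
  moreover have "g x \<in> {0..1}" for x using l by (simp add: g)
  ultimately have sig: "g \<in> signals p" using p by (simp add: signals_def)
  show ?thesis
  proof (cases "s \<le> t")
    case True
    show ?thesis
      by (rule nested_bi_upset_signals_threshold[OF f(2) sig, where ?P1.0 = "\<lambda>x. t < x" and ?P2.0 = "\<lambda>x. s < x" and c = l])
         (use True l in \<open>auto simp: g\<close>)
  next
    case False
    show ?thesis
      by (rule nested_bi_upset_signals_threshold[OF f(2) sig, where ?P1.0 = "\<lambda>x. s < x" and ?P2.0 = "\<lambda>x. t < x" and c = "1 - l"])
         (use False l in \<open>auto simp: g\<close>)
  qed
qed

text \<open>The strict inequality holds for exactly the \<open>j\<close> from 1 up to the ceiling of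
  \<open>m * y\<close> minus 1. For \<open>y = 0\<close> the truncated subtraction of naturals
  yields the correct count 0.\<close>

lemma staircase_approx:
  assumes m: "0 < m" and y: "0 \<le> y" "y \<le> (1::real)"
  shows "(\<Sum>j\<in>{1..m}. 1 / real m * of_bool (real j / real m < y)) \<le> y"
    and "y - 1 / real m \<le> (\<Sum>j\<in>{1..m}. 1 / real m * of_bool (real j / real m < y))"
proof -
  have "{j \<in> {1..m}. real j / real m < y} = {1..<nat \<lceil>m * y\<rceil>}"
  proof (intro equalityI subsetI)
    fix j assume "j \<in> {j \<in> {1..m}. real j / real m < y}"
    then have "1 \<le> j" "real j < m * y" using m by (auto simp: field_simps)
    then have "1 \<le> j" "int j < \<lceil>m * y\<rceil>" by (simp_all add: less_ceiling_iff)
    then show "j \<in> {1..<nat \<lceil>m * y\<rceil>}" by simp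
  next
    fix j assume j: "j \<in> {1..<nat \<lceil>m * y\<rceil>}"
    then have "j < nat \<lceil>m * y\<rceil>" by simp
    then have "int j < \<lceil>m * y\<rceil>" by linarith
    then have "real j < m * y" by (simp add: less_ceiling_iff)
    moreover have "m * y \<le> m" using y m by simp
    then have "j < m" using \<open>real j < m * y\<close> by linarith
    ultimately show "j \<in> {j \<in> {1..m}. real j / real m < y}" using j m by (auto simp: field_simps)
  qed
  then have "(\<Sum>j\<in>{1..m}. of_bool (real j / real m < y)) = real (nat \<lceil>m * y\<rceil> - 1)"
    by (simp add: Int_def)
  then have eq: "(\<Sum>j\<in>{1..m}. 1 / real m * of_bool (real j / real m < y)) = real (nat \<lceil>m * y\<rceil> - 1) / m"
    unfolding sum_distrib_left[symmetric] by simp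
  have "0 \<le> m * y" using y by simp
  then have "real (nat \<lceil>m * y\<rceil> - 1) \<le> m * y" "m * y - 1 \<le> real (nat \<lceil>m * y\<rceil> - 1)" by linarith+
  then have "real (nat \<lceil>m * y\<rceil> - 1) / m \<le> m * y / m" "(m * y - 1) / m \<le> real (nat \<lceil>m * y\<rceil> - 1) / m"
    by - (rule divide_right_mono, assumption, simp)+
  then show "(\<Sum>j\<in>{1..m}. 1 / real m * of_bool (real j / real m < y)) \<le> y"
    and "y - 1 / real m \<le> (\<Sum>j\<in>{1..m}. 1 / real m * of_bool (real j / real m < y))"
    unfolding eq using m by (simp_all add: diff_divide_distrib)
qed

text \<open>The staircase \<open>s\<close> costs at most \<open>1 / m\<close> and has mean
  \<open>P\<close> between \<open>p - 1 / m\<close> and \<open>p\<close>. Mixing in the constant 1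
  with weight \<open>e\<close> raises the mean back to \<open>p\<close> and costs at most
  \<open>e\<close>, hence the constant \<open>1 + 1 / (1 - p)\<close>. The result is an average of
  level-set indicators with mean \<open>p\<close>, to which \<open>two_point_decomposition\<close>
  applies.\<close>

lemma mono_signal_step_approx:
  fixes f :: "('n::finite \<Rightarrow> real) \<Rightarrow> real" and m :: nat
  assumes p: "p < 1" and f: "f \<in> mono_signals p" and m: "0 < m"
  obtains g where "unit_valued g" "marginals g \<in> convex hull (Q_star p)"
    "(\<integral>x. \<bar>f x - g x\<bar> \<partial>cube UNIV) \<le> (1 + 1 / (1 - p)) / m"
proof -
  have fu: "unit_valued f" and fp: "(\<integral>x. f x \<partial>cube UNIV) = p" and fm: "ae_mono f"
    using f by (auto simp: mono_signals_def signals_eq)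
  have [measurable]: "f \<in> borel_measurable (cube UNIV)" by (rule unit_valued_measurable[OF fu])
  \<comment> \<open>Threshold -1 lies below all values of \<open>f\<close>, so index 0 stands for
    the constant signal 1.\<close>
  define th where "th j = (if j = 0 then - 1 else real j / real m)" for j
  define F where "F j x = (of_bool (th j < f x) :: real)" for j x
  have F: "unit_valued (F j)" for j
  proof -
    have "F j \<in> borel_measurable (cube UNIV)" unfolding F_def by measurable
    then show ?thesis by (simp add: unit_valued_def F_def)
  qed
  define s where "s x = (\<Sum>j\<in>{1..m}. 1 / real m * F j x)" for x
  have s_eq: "s x = (\<Sum>j\<in>{1..m}. 1 / real m * of_bool (real j / real m < f x))" for x
    unfolding s_def F_def th_def by (intro sum.cong) auto
  have s: "s x \<le> f x" "f x - 1 / m \<le> s x" "0 \<le> s x" if "x \<in> space (cube UNIV)" for x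
    using staircase_approx[OF m unit_valued_bounds[OF fu that]] unfolding s_eq
    by (auto intro!: sum_nonneg)
  have su: "unit_valued s"
    using marginals_weighted_sum[of "{1..m}" F "\<lambda>_. 1 / m"] F m unfolding s_def by simp
  define P where "P = (\<integral>x. s x \<partial>cube UNIV)"
  have P: "P \<le> p" "p - 1 / m \<le> P"
  proof -
    show "P \<le> p"
      unfolding P_def fp[symmetric]
      by (rule integral_mono) (use s fu su unit_valued_integrable in auto)
    have "integrable (cube UNIV) (\<lambda>x. f x - 1 / m)"
      by (intro Bochner_Integration.integrable_diff unit_valued_integrable[OF fu] cube.integrable_const)
    then have "(\<integral>x. f x - 1 / m \<partial>cube UNIV) \<le> P"
      unfolding P_def by (rule integral_mono) (use s su unit_valued_integrable in auto)
    then show "p - 1 / m \<le> P" using fu fp by (simp add: unit_valued_integrable cube.prob_space)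
  qed
  \<comment> \<open>The solution of \<open>e + (1 - e) * P = p\<close>.\<close>
  define e where "e = (p - P) / (1 - P)"
  have P1: "0 < 1 - P" "1 - p \<le> 1 - P" using P p by auto
  have e: "0 \<le> e" "e \<le> 1" "e \<le> (1 / m) / (1 - p)"
  proof -
    show "0 \<le> e" "e \<le> 1" unfolding e_def using P P1 p by (auto simp: divide_simps)
    show "e \<le> (1 / m) / (1 - p)" unfolding e_def using P P1 p m by (intro frac_le) auto
  qed
  define w where "w j = (if j = 0 then e else (1 - e) / m)" for j :: nat
  define g where "g x = (\<Sum>j\<in>{0..m}. w j * F j x)" for x
  have atLeast0: "{0..m} = insert 0 {1..m}" by auto
  have w0: "0 \<le> w j" for j using e by (simp add: w_def)
  have w1: "sum w {0..m} = 1" unfolding atLeast0 using m by (simp add: w_def)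
  have gu: "unit_valued g" "marginals g = (\<Sum>j\<in>{0..m}. w j *\<^sub>R marginals (F j))"
    using marginals_weighted_sum[of "{0..m}" F w] F w0 w1 unfolding g_def by auto
  have g_eq: "g x = e + (1 - e) * s x" if "x \<in> space (cube UNIV)" for x
  proof -
    have "-1 < f x" using unit_valued_bounds(1)[OF fu that] by linarith
    then have "F 0 x = 1" by (simp add: F_def th_def)
    then show ?thesis
      unfolding g_def atLeast0 s_def by (simp add: w_def sum_distrib_left)
  qed
  show ?thesis
  proof (rule that[OF gu(1)])
    show "marginals g \<in> convex hull (Q_star p)"
      unfolding gu(2)
    proof (rule two_point_decomposition[where v = "\<lambda>j. \<integral>x. F j x \<partial>cube UNIV" and p = p])
      have "(\<Sum>j\<in>{0..m}. w j * (\<integral>x. F j x \<partial>cube UNIV)) = (\<integral>x. g x \<partial>cube UNIV)"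
        unfolding g_def using F by (simp add: unit_valued_integrable)
      also have "\<dots> = (\<integral>x. e + (1 - e) * s x \<partial>cube UNIV)"
        by (rule Bochner_Integration.integral_cong) (use g_eq in auto)
      also have "\<dots> = e + (1 - e) * P"
        using su by (simp add: unit_valued_integrable cube.prob_space P_def)
      also have "\<dots> = P + e * (1 - P)" by (simp add: algebra_simps)
      also have "\<dots> = p" using P1 by (simp add: e_def)
      finally show "(\<Sum>j\<in>{0..m}. w j * (\<integral>x. F j x \<partial>cube UNIV)) = p" .
      fix i k l assume l: "0 \<le> l" "l \<le> 1"
        and lp: "l * (\<integral>x. F i x \<partial>cube UNIV) + (1 - l) * (\<integral>x. F k x \<partial>cube UNIV) = p"
      let ?h = "\<lambda>x. l * F i x + (1 - l) * F k x"
      have "?h \<in> nested_bi_upset_signals p"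
      proof (rule level_pair_nested_bi_upset[OF fu fm l])
        show "?h = (\<lambda>x. l * of_bool (th i < f x) + (1 - l) * of_bool (th k < f x))"
          by (simp add: F_def)
        show "(\<integral>x. ?h x \<partial>cube UNIV) = p"
          using F lp by (simp add: unit_valued_integrable)
      qed
      then have "marginals ?h \<in> Q_star p" by (auto simp: Q_star_eq)
      moreover have "marginals ?h = l *\<^sub>R marginals (F i) + (1 - l) *\<^sub>R marginals (F k)"
        by (rule marginals_lincomb[OF F F unit_valued_convex_comb[OF F F]]) (use l in auto)
      ultimately show "l *\<^sub>R marginals (F i) + (1 - l) *\<^sub>R marginals (F k) \<in> convex hull (Q_star p)"
        using hull_subset by fastforce
    qed (use w0 w1 in auto)
    have "\<bar>f x - g x\<bar> \<le> (1 + 1 / (1 - p)) / m" if x: "x \<in> space (cube UNIV)" for x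
    proof -
      have "\<bar>f x - g x\<bar> \<le> \<bar>f x - s x\<bar> + e * \<bar>1 - s x\<bar>"
      proof -
        have "f x - g x = (f x - s x) - e * (1 - s x)" unfolding g_eq[OF x] by (simp add: algebra_simps)
        moreover have "\<bar>e * (1 - s x)\<bar> = e * \<bar>1 - s x\<bar>" using e(1) by (simp add: abs_mult)
        ultimately show ?thesis by (metis abs_triangle_ineq4)
      qed
      also have "\<dots> \<le> 1 / m + e * 1"
        using s[OF x] unit_valued_bounds[OF fu x] e(1) by (intro add_mono mult_left_mono) auto
      also have "\<dots> \<le> (1 + 1 / (1 - p)) / m" using e(3) by (simp add: add_divide_distrib mult.commute)
      finally show ?thesis .
    qed
    then show "(\<integral>x. \<bar>f x - g x\<bar> \<partial>cube UNIV) \<le> (1 + 1 / (1 - p)) / m"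
      using fu gu(1) by (intro cube.integral_le_const) (auto simp: unit_valued_integrable)
  qed
qed

lemma marginals_in_closure_hull_Q_star:
  fixes f :: "('n::finite \<Rightarrow> real) \<Rightarrow> real"
  assumes p: "p < 1" and f: "f \<in> mono_signals p"
  shows "marginals f \<in> closure (convex hull (Q_star p))"
  unfolding closure_approachable
proof (intro allI impI)
  fix e :: real assume e: "0 < e"
  have fu: "unit_valued f" using f by (auto simp: mono_signals_def signals_eq)
  define B where "B = CARD('n) * (1 + 1 / (1 - p))"
  obtain m :: nat where m: "B / e < m" using reals_Archimedean2 by blast
  have B: "0 < B" using p by (auto simp: B_def intro!: mult_pos_pos add_pos_pos)
  then have "0 < B / e" using e by simp
  then have m0: "0 < m" using m by (metis of_nat_0_less_iff order_less_trans)
  obtain g where g: "unit_valued g" "marginals g \<in> convex hull (Q_star p)"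
    "(\<integral>x. \<bar>f x - g x\<bar> \<partial>cube UNIV) \<le> (1 + 1 / (1 - p)) / m"
    using mono_signal_step_approx[OF p f m0] .
  have "norm (marginals f - marginals g) \<le> CARD('n) * ((1 + 1 / (1 - p)) / m)"
    using norm_marginals_diff[OF fu g(1)] mult_left_mono[OF g(3), of "real CARD('n)"] by simp
  also have "\<dots> = B / m" by (simp add: B_def)
  also have "\<dots> < e" using m m0 e by (simp add: field_simps)
  finally have "dist (marginals g) (marginals f) < e"
    by (simp add: dist_norm norm_minus_commute)
  then show "\<exists>y\<in>convex hull (Q_star p). dist y (marginals f) < e" using g(2) by blast
qed

text \<open>From here on the closed convex hull is handled through this description: every point of
  it has a monotone signal behind it.\<close>

lemma closure_hull_Q_star:
  "p < 1 \<Longrightarrow> closure (convex hull (Q_star p)) = marginals ` mono_signals p"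
  using closure_hull_Q_star_subset[of p] marginals_in_closure_hull_Q_star[of p] by blast

section \<open>Extreme points\<close>

text \<open>A Lipschitz substitute for the step at threshold \<open>a\<close>, sharper as
  \<open>k\<close> grows. The slope bound \<open>k\<close> is what leaves a monotone remainder when
  a multiple of the ramp is split off from the signal.\<close>

definition ramp :: "nat \<Rightarrow> real \<Rightarrow> real \<Rightarrow> real" where
  "ramp k a x = min 1 (max 0 (real k * (x - a)))"

lemma ramp_bounds: "0 \<le> ramp k a x" "ramp k a x \<le> 1"
  by (auto simp: ramp_def)

lemma ramp_mono: "x \<le> y \<Longrightarrow> ramp k a x \<le> ramp k a y"
  unfolding ramp_def by (intro min.mono max.mono order_refl mult_left_mono) auto

text \<open>Continuity in the threshold, not in the argument, for the intermediate value argument in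
  \<open>exists_ramp\<close>.\<close>

lemma ramp_Lipschitz: "\<bar>ramp k a x - ramp k b x\<bar> \<le> real k * \<bar>a - b\<bar>"
proof -
  have "\<bar>ramp k a x - ramp k b x\<bar> \<le> \<bar>real k * (x - a) - real k * (x - b)\<bar>"
    unfolding ramp_def by (auto simp: min_def max_def abs_if)
  also have "\<dots> = real k * \<bar>a - b\<bar>"
    by (simp add: abs_mult abs_minus_commute flip: right_diff_distrib)
  finally show ?thesis .
qed

text \<open>Equivalently, \<open>k * x - ramp k a x\<close> is increasing in \<open>x\<close>; this
  makes the remainder in \<open>extreme_ramp\<close> monotone.\<close>

lemma ramp_slope: "x \<le> y \<Longrightarrow> ramp k a y - ramp k a x \<le> real k * (y - x)"
proof -
  assume xy: "x \<le> y"
  then have "real k * (x - a) \<le> real k * (y - a)" by (intro mult_left_mono) auto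
  moreover have "real k * (y - x) = real k * (y - a) - real k * (x - a)" by (simp add: algebra_simps)
  ultimately show ?thesis unfolding ramp_def by linarith
qed

lemma ramp_upper: "0 \<le> a \<Longrightarrow> 0 \<le> x \<Longrightarrow> ramp k a x \<le> k * x"
  unfolding ramp_def by (auto intro!: min.coboundedI2 mult_left_mono)

text \<open>Together with \<open>ramp_upper\<close> this confines \<open>k * x - ramp k a x\<close>
  to the interval from 0 to \<open>k - 1\<close>, so that dividing by \<open>k - 1\<close> gives a
  value in [0,1]. The bound on \<open>a\<close> ensures that the ramp has reached 1 at
  \<open>x = 1\<close>.\<close>

lemma ramp_lower: "0 < k \<Longrightarrow> a \<le> 1 - 1 / k \<Longrightarrow> x \<le> 1 \<Longrightarrow> 1 - real k * (1 - x) \<le> ramp k a x"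
proof -
  assume k: "0 < k" and a: "a \<le> 1 - 1 / k" and x: "x \<le> 1"
  have "real k * a \<le> real k * (1 - 1 / k)" using a by (intro mult_left_mono) auto
  then have "real k * a \<le> real k - 1" using k by (simp add: right_diff_distrib)
  then have "1 - real k * (1 - x) \<le> real k * (x - a)" by (simp add: algebra_simps)
  moreover have "0 \<le> real k * (1 - x)" using x by simp
  ultimately show ?thesis unfolding ramp_def by linarith
qed

text \<open>At threshold 0 the ramp lies above the identity on [0,1], at threshold
  \<open>1 - 1 / k\<close> below it. By continuity of the mean, some threshold in between keeps the
  mean at \<open>p\<close>.\<close>

lemma exists_ramp:
  fixes f :: "('n::finite \<Rightarrow> real) \<Rightarrow> real"
  assumes f: "unit_valued f" and p: "(\<integral>x. f x \<partial>cube UNIV) = p" and k: "0 < k"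
  obtains a where "0 \<le> a" "a \<le> 1 - 1 / k" "unit_valued (\<lambda>x. ramp k a (f x))"
    "(\<integral>x. ramp k a (f x) \<partial>cube UNIV) = p"
proof -
  have [measurable]: "f \<in> borel_measurable (cube UNIV)" by (rule unit_valued_measurable[OF f])
  have u: "unit_valued (\<lambda>x. ramp k a (f x))" for a
  proof -
    have "(\<lambda>x. ramp k a (f x)) \<in> borel_measurable (cube UNIV)" unfolding ramp_def by measurable
    then show ?thesis using ramp_bounds by (auto simp: unit_valued_def)
  qed
  note int = unit_valued_integrable[OF u] unit_valued_integrable[OF f]
  let ?J = "\<lambda>a. \<integral>x. ramp k a (f x) \<partial>cube UNIV"
  have "k-lipschitz_on UNIV ?J"
  proof (rule lipschitz_onI)
    fix a b :: real
    have "dist (?J a) (?J b) = \<bar>\<integral>x. ramp k a (f x) - ramp k b (f x) \<partial>cube UNIV\<bar>"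
      using int by (simp add: dist_real_def)
    also have "\<dots> \<le> (\<integral>x. \<bar>ramp k a (f x) - ramp k b (f x)\<bar> \<partial>cube UNIV)"
      by (rule integral_abs_bound)
    also have "\<dots> \<le> real k * \<bar>a - b\<bar>"
      by (rule cube.integral_le_const) (use int ramp_Lipschitz in auto)
    finally show "dist (?J a) (?J b) \<le> real k * dist a b" by (simp add: dist_real_def)
  qed simp
  then have "continuous_on {0..1 - 1 / k} ?J"
    by (rule continuous_on_subset[OF lipschitz_on_continuous_on]) simp
  moreover have "p \<le> ?J 0"
    unfolding p[symmetric]
  proof (rule integral_mono)
    fix x assume x: "x \<in> space (cube (UNIV :: 'n set))"
    have "f x \<le> real k * f x" using k unit_valued_bounds(1)[OF f x] by (simp add: mult_le_cancel_right1)
    then show "f x \<le> ramp k 0 (f x)" using unit_valued_bounds[OF f x] by (simp add: ramp_def)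
  qed (use int in auto)
  moreover have "?J (1 - 1 / k) \<le> p"
    unfolding p[symmetric]
  proof (rule integral_mono)
    fix x assume x: "x \<in> space (cube (UNIV :: 'n set))"
    have "(real k - 1) * f x \<le> (real k - 1) * 1"
      using k unit_valued_bounds(2)[OF f x] by (intro mult_left_mono) auto
    then have "real k * (f x - (1 - 1 / k)) \<le> f x" using k by (simp add: algebra_simps)
    then show "ramp k (1 - 1 / k) (f x) \<le> f x" using unit_valued_bounds[OF f x] by (auto simp: ramp_def)
  qed (use int in auto)
  ultimately obtain a where "0 \<le> a" "a \<le> 1 - 1 / k" "?J a = p"
    using IVT2'[of ?J "1 - 1 / k" p 0] k by auto
  then show ?thesis using that u by blast
qed

lemma extreme_point_mix:
  fixes q :: "'a::real_vector"
  assumes ext: "q extreme_point_of K" and ab: "a \<in> K" "b \<in> K"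
    and u: "0 < u" "u < 1" and q: "q = u *\<^sub>R a + (1 - u) *\<^sub>R b"
  shows "a = q"
proof (cases "a = b")
  case True
  then show ?thesis using q by (simp flip: scaleR_left_distrib)
next
  case False
  then have "q \<in> open_segment b a"
    unfolding in_segment using u q by (auto simp: add.commute)
  then show ?thesis using ext ab by (auto simp: extreme_point_of_def)
qed

text \<open>The signal \<open>f\<close> is the mixture of \<open>g\<close> with weight
  \<open>1 / k\<close> and of the remainder \<open>h\<close> with weight \<open>1 - 1 / k\<close>.
  Both are monotone signals of mean \<open>p\<close>, so extremality of the marginals of
  \<open>f\<close> forces those of \<open>g\<close> to agree with them. \<open>2 \<le> k\<close>
  puts the weights strictly between 0 and 1.\<close>

lemma extreme_ramp:
  fixes f :: "('n::finite \<Rightarrow> real) \<Rightarrow> real"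
  assumes f: "f \<in> mono_signals p" and ext: "marginals f extreme_point_of (marginals ` mono_signals p)"
    and k: "2 \<le> k" and a: "0 \<le> a" "a \<le> 1 - 1 / k"
    and gu: "unit_valued (\<lambda>x. ramp k a (f x))" and gp: "(\<integral>x. ramp k a (f x) \<partial>cube UNIV) = p"
  shows "marginals (\<lambda>x. ramp k a (f x)) = marginals f"
proof -
  have fu: "unit_valued f" and fp: "(\<integral>x. f x \<partial>cube UNIV) = p" and fm: "ae_mono f"
    using f by (auto simp: mono_signals_def signals_eq)
  obtain N where N: "N \<in> null_sets (cube UNIV)"
    "\<And>x y. x \<in> space (cube UNIV) - N \<Longrightarrow> y \<in> space (cube UNIV) - N \<Longrightarrow> x \<le> y \<Longrightarrow> f x \<le> f y"
    using fm unfolding ae_mono_def by blast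
  define g where "g x = ramp k a (f x)" for x
  define h where "h x = (real k * f x - g x) / (real k - 1)" for x
  note g = gu[folded g_def] gp[folded g_def]
  have k1: "0 < real k - 1" using k by simp
  have "g \<in> mono_signals p"
  proof -
    have "ae_mono g"
      unfolding ae_mono_def g_def by (intro bexI[OF _ N(1)] ballI impI ramp_mono N(2))
    then show ?thesis using g by (simp add: mono_signals_def signals_eq)
  qed
  moreover have hu: "unit_valued h"
    unfolding unit_valued_def
  proof (intro conjI ballI)
    show "h \<in> borel_measurable (cube UNIV)"
      unfolding h_def using unit_valued_measurable[OF fu] unit_valued_measurable[OF g(1)] by measurable
    fix x :: "'n \<Rightarrow> real" assume x: "x \<in> space (cube UNIV)"
    have "g x \<le> real k * f x" "1 - real k * (1 - f x) \<le> g x"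
      unfolding g_def using ramp_upper ramp_lower unit_valued_bounds[OF fu x] a k by auto
    then show "h x \<in> {0..1}"
      unfolding h_def using k1 by (simp add: field_simps)
  qed
  have "h \<in> mono_signals p"
  proof -
    have "(\<integral>x. h x \<partial>cube UNIV) = (real k * p - p) / (real k - 1)"
      unfolding h_def using fu g fp by (simp add: unit_valued_integrable)
    also have "\<dots> = p" using k1 by (simp add: field_simps)
    finally have "(\<integral>x. h x \<partial>cube UNIV) = p" .
    moreover have "h x \<le> h y" if "f x \<le> f y" for x y
      using ramp_slope[OF that, of k a] k1
      unfolding h_def g_def by (intro divide_right_mono) (auto simp: algebra_simps)
    then have "ae_mono h"
      unfolding ae_mono_def by (intro bexI[OF _ N(1)] ballI impI) (use N(2) in blast)
    ultimately show ?thesis using hu by (simp add: mono_signals_def signals_eq)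
  qed
  moreover have "f = (\<lambda>x. (1 / k) * g x + (1 - 1 / k) * h x)"
  proof
    fix x
    have "(1 - 1 / k) * h x = (real k * f x - g x) / k"
      using k1 unfolding h_def by (simp add: field_simps)
    then show "f x = (1 / k) * g x + (1 - 1 / k) * h x" using k by (simp add: field_simps)
  qed
  moreover have "marginals (\<lambda>x. (1 / k) * g x + (1 - 1 / k) * h x)
      = (1 / k) *\<^sub>R marginals g + (1 - 1 / k) *\<^sub>R marginals h"
    by (rule mono_signals_convex_comb(2)) (use calculation k in auto)
  ultimately have "marginals g = marginals f"
    by (intro extreme_point_mix[OF ext, where u = "1 / k" and b = "marginals h"]) (use k in auto)
  then show ?thesis by (simp add: g_def[abs_def])
qed

text \<open>All the ramps have exactly the marginals \<open>q\<close>, so any a.e. limit has them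
  too. Compactness of [0,1] is used twice: for the thresholds, with limit \<open>t\<close>, and then
  for the ramp values at \<open>t\<close>, with limit \<open>c\<close>. Away from \<open>t\<close>
  the growing slope forces the limit to be 0 or 1.\<close>

lemma extreme_points_subset_Q_star:
  fixes q :: "L1 ^ 'n::finite"
  assumes p: "p < 1" and q: "q extreme_point_of closure (convex hull (Q_star p))"
  shows "q \<in> Q_star p"
proof -
  note ext = q[unfolded closure_hull_Q_star[OF p]]
  obtain f where f: "f \<in> mono_signals p" and qf: "q = marginals f"
    using ext by (auto simp: extreme_point_of_def)
  have fu: "unit_valued f" and fp: "(\<integral>x. f x \<partial>cube UNIV) = p" and fm: "ae_mono f"
    using f by (auto simp: mono_signals_def signals_eq)
  \<comment> \<open>The shift by 2 keeps the slope at least 2, as \<open>extreme_ramp\<close>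
    requires.\<close>
  have "\<exists>a. 0 \<le> a \<and> a \<le> 1 - 1 / real (n + 2) \<and> unit_valued (\<lambda>x. ramp (n + 2) a (f x))
      \<and> (\<integral>x. ramp (n + 2) a (f x) \<partial>cube UNIV) = p" for n
    using exists_ramp[OF fu fp, of "n + 2"] by (metis add_gr_0 zero_less_numeral)
  then obtain a where a: "\<And>n. 0 \<le> a n" "\<And>n. a n \<le> 1 - 1 / real (n + 2)"
      and ru: "\<And>n. unit_valued (\<lambda>x. ramp (n + 2) (a n) (f x))"
      and rp: "\<And>n. (\<integral>x. ramp (n + 2) (a n) (f x) \<partial>cube UNIV) = p"
    by metis
  have rm: "marginals (\<lambda>x. ramp (n + 2) (a n) (f x)) = q" for n
    unfolding qf by (rule extreme_ramp[OF f ext[unfolded qf] _ a ru rp]) simp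
  have seq: "seq_compact {0..1::real}" by (simp add: compact_imp_seq_compact)
  have "\<forall>n. a n \<in> {0..1}"
  proof
    fix n
    have "1 - 1 / real (n + 2) \<le> 1" by simp
    with a(2)[of n] have "a n \<le> 1" by (rule order_trans)
    then show "a n \<in> {0..1}" using a(1)[of n] by simp
  qed
  then obtain t r1 where t: "strict_mono r1" "(a \<circ> r1) \<longlonglongrightarrow> t"
    by (rule seq_compactE[OF seq])
  have "\<forall>n. ramp (r1 n + 2) (a (r1 n)) t \<in> {0..1}" using ramp_bounds by auto
  then obtain c r2 where c: "c \<in> {0..1}" "strict_mono r2"
      "((\<lambda>n. ramp (r1 n + 2) (a (r1 n)) t) \<circ> r2) \<longlonglongrightarrow> c"
    by (rule seq_compactE[OF seq])
  define r where "r = r1 \<circ> r2"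
  have r: "strict_mono r" using t(1) c(2) by (simp add: r_def strict_mono_o)
  have at: "(\<lambda>n. a (r n)) \<longlonglongrightarrow> t"
    using LIMSEQ_subseq_LIMSEQ[OF t(2) c(2)] by (simp add: r_def o_def)
  \<comment> \<open>The level set where \<open>f\<close> equals \<open>t\<close> may have positive
    measure; there the limit is \<open>c\<close>, the intermediate value of the nested bi-upset
    signal.\<close>
  define \<phi> where "\<phi> x = (if t < x then 1 else if t \<le> x then c else 0)" for x
  have lim: "(\<lambda>n. ramp (r n + 2) (a (r n)) x) \<longlonglongrightarrow> \<phi> x" for x
  proof -
    consider "x < t" | "x = t" | "t < x" by linarith
    then show ?thesis
    proof cases
      case 1
      have "\<forall>\<^sub>F n in sequentially. ramp (r n + 2) (a (r n)) x = 0"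
        using order_tendstoD(1)[OF at 1]
      proof eventually_elim
        case (elim n)
        then have "real (r n + 2) * (x - a (r n)) \<le> 0" by (intro mult_nonneg_nonpos) auto
        then show ?case unfolding ramp_def by linarith
      qed
      then show ?thesis using 1 by (simp add: \<phi>_def tendsto_eventually)
    next
      case 2
      then show ?thesis using c(3) by (simp add: \<phi>_def r_def o_def)
    next
      case 3
      \<comment> \<open>Half the gap: eventually the threshold is below
        \<open>t + d = x - d\<close>, and a slope of at least \<open>1 / d\<close> then lifts the
        ramp to 1 at \<open>x\<close>.\<close>
      define d where "d = (x - t) / 2"
      have d: "0 < d" "x - d = t + d" using 3 by (auto simp: d_def field_simps)
      obtain M :: nat where M: "1 / d < M" using reals_Archimedean2 by blast
      have "\<forall>\<^sub>F n in sequentially. a (r n) < t + d"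
        using order_tendstoD(2)[OF at, of "t + d"] d by simp
      then have "\<forall>\<^sub>F n in sequentially. ramp (r n + 2) (a (r n)) x = 1"
        using eventually_ge_at_top[of M]
      proof eventually_elim
        case (elim n)
        have "M \<le> r n + 2" using elim(2) seq_suble[OF r, of n] by simp
        then have "1 / d \<le> real (r n + 2)" using M by linarith
        then have "1 \<le> real (r n + 2) * d" using d by (simp add: field_simps)
        also have "\<dots> \<le> real (r n + 2) * (x - a (r n))"
          using elim(1) d by (intro mult_left_mono) auto
        finally show ?case unfolding ramp_def by linarith
      qed
      then show ?thesis using 3 by (simp add: \<phi>_def tendsto_eventually)
    qed
  qed
  define g where "g x = \<phi> (f x)" for x
  have [measurable]: "f \<in> borel_measurable (cube UNIV)" by (rule unit_valued_measurable[OF fu])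
  have "g \<in> borel_measurable (cube UNIV)" unfolding g_def \<phi>_def by measurable
  then have gu: "unit_valued g" using c(1) by (simp add: unit_valued_def g_def \<phi>_def)
  note conv = tendsto_marginals_AE[OF ru gu, of r]
  have "(\<lambda>n. marginals (\<lambda>x. ramp (r n + 2) (a (r n)) (f x))) \<longlonglongrightarrow> marginals g"
    "(\<lambda>n. \<integral>x. ramp (r n + 2) (a (r n)) (f x) \<partial>cube UNIV) \<longlonglongrightarrow> (\<integral>x. g x \<partial>cube UNIV)"
    by (rule conv; use lim in \<open>simp add: g_def\<close>)+
  then have "marginals g = q" "g \<in> signals p"
    using rm rp gu by (auto simp: LIMSEQ_const_iff signals_eq)
  moreover have "g \<in> nested_bi_upset_signals p"
    by (rule nested_bi_upset_signals_threshold[OF fm \<open>g \<in> signals p\<close>, where ?P1.0 = "\<lambda>x. t < x" and ?P2.0 = "\<lambda>x. t \<le> x" and c = c])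
       (use c(1) in \<open>auto simp: g_def \<phi>_def\<close>)
  ultimately show ?thesis by (auto simp: Q_star_eq)
qed

section \<open>Quantile functions of feasible belief distributions\<close>

lemma belief_mass_outside:
  assumes "belief_distribution \<mu>"
  shows "x < 0 \<Longrightarrow> measure (\<mu> i) {..x} = 0" "1 \<le> x \<Longrightarrow> measure (\<mu> i) {..x} = 1"
proof -
  interpret prob_space "\<mu> i" using assms by (simp add: belief_distribution_def)
  have [simp]: "sets (\<mu> i) = sets borel" using assms by (simp add: belief_distribution_def)
  have one: "prob {0..1} = 1" using assms by (simp add: belief_distribution_def)
  show "measure (\<mu> i) {..x} = 0" if "x < 0"
  proof -
    have "prob ({..x} \<union> {0..1}) = prob {..x} + prob {0..1}"
      by (rule finite_measure_Union) (use that in auto)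
    then show ?thesis using one prob_le_1[of "{..x} \<union> {0..1}"] measure_nonneg[of "\<mu> i" "{..x}"] by linarith
  qed
  show "measure (\<mu> i) {..x} = 1" if "1 \<le> x"
  proof -
    have "prob {0..1} \<le> prob {..x}" by (rule finite_measure_mono) (use that in auto)
    then show ?thesis using one prob_le_1[of "{..x}"] by linarith
  qed
qed

lemma real_distribution_belief: "belief_distribution \<mu> \<Longrightarrow> real_distribution (\<mu> i)"
  unfolding real_distribution_def real_distribution_axioms_def belief_distribution_def
  by (auto dest: sets_eq_imp_space_eq)

text \<open>Right-continuity of the cdf makes the infimum defining the quantile attained, which
  gives the Galois connection between quantile and cdf.\<close>

lemma quantile_le_iff:
  assumes \<mu>: "belief_distribution \<mu>" and t: "t \<in> {0..1}" and x: "x \<in> {0..1}"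
  shows "quantile (\<mu> i) t \<le> x \<longleftrightarrow> t \<le> measure (\<mu> i) {..x}"
proof -
  interpret real_distribution "\<mu> i" by (rule real_distribution_belief[OF \<mu>])
  define S where "S = {x \<in> {0..1}. t \<le> cdf (\<mu> i) x}"
  define q where "q = quantile (\<mu> i) t"
  have q: "q = Inf S" by (simp add: q_def quantile_def S_def cdf_def)
  have one: "1 \<in> S" using t belief_mass_outside(2)[OF \<mu>, of 1 i] by (simp add: S_def cdf_def)
  have bdd: "bdd_below S" by (rule bdd_belowI[of _ 0]) (auto simp: S_def)
  have "t \<le> cdf (\<mu> i) q"
  proof (rule tendsto_lowerbound)
    show "((cdf (\<mu> i)) \<longlongrightarrow> cdf (\<mu> i) q) (at_right q)"
      using cdf_is_right_cont[of q] by (simp add: continuous_within)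
    show "\<forall>\<^sub>F y in at_right q. t \<le> cdf (\<mu> i) y"
      unfolding eventually_at_filter
    proof (intro always_eventually allI impI)
      fix y assume "y \<noteq> q" "y \<in> {q<..}"
      then obtain s where s: "s \<in> S" "s < y" using cInf_lessD[of S y] one unfolding q by auto
      then have "t \<le> cdf (\<mu> i) s" by (simp add: S_def)
      also have "\<dots> \<le> cdf (\<mu> i) y" using s(2) by (intro cdf_nondecreasing) simp
      finally show "t \<le> cdf (\<mu> i) y" .
    qed
  qed simp
  then have "q \<le> x \<Longrightarrow> t \<le> cdf (\<mu> i) x" using cdf_nondecreasing[of q x] by linarith
  moreover have "t \<le> cdf (\<mu> i) x \<Longrightarrow> q \<le> x"
    unfolding q by (rule cInf_lower[OF _ bdd]) (use x in \<open>simp add: S_def\<close>)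
  ultimately show ?thesis by (auto simp: q_def cdf_def)
qed

lemma quantile_in_unit:
  assumes \<mu>: "belief_distribution \<mu>" and t: "t \<in> {0..1}"
  shows "quantile (\<mu> i) t \<in> {0..1}"
proof -
  have "1 \<in> {x \<in> {0..1}. t \<le> measure (\<mu> i) {..x}}"
    using t belief_mass_outside(2)[OF \<mu>, of 1 i] by simp
  then show ?thesis
    unfolding quantile_def
    by (auto intro!: cInf_greatest cInf_lower2[where x = 1] bdd_belowI[of _ 0])
qed

lemma quantile_integrable: "belief_distribution \<mu> \<Longrightarrow> integrable unit_interval (quantile (\<mu> i))"
  by (rule integrable_quantile) (auto simp: belief_distribution_def)

lemma quantile_measurable: "belief_distribution \<mu> \<Longrightarrow> quantile (\<mu> i) \<in> borel_measurable unit_interval"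
  using quantile_integrable by (rule borel_measurable_integrable)

lemma measure_unit_interval_atMost:
  assumes "c \<in> {0..1}"
  shows "measure unit_interval {t \<in> {0..1}. t \<le> c} = c"
proof -
  have "{t \<in> {0..1}. t \<le> c} = {0..c}" using assms by auto
  then show ?thesis
    using assms unfolding unit_interval_def by (subst measure_restrict_space) auto
qed

text \<open>Inverse transform sampling: by \<open>quantile_le_iff\<close> the event that the
  quantile is at most \<open>x\<close> is the event that the uniform variable is at most the cdf at
  \<open>x\<close>.\<close>

lemma distr_quantile:
  assumes \<mu>: "belief_distribution \<mu>"
  shows "distr unit_interval borel (quantile (\<mu> i)) = \<mu> i"
proof (rule cdf_unique)
  interpret \<mu>: real_distribution "\<mu> i" by (rule real_distribution_belief[OF \<mu>])
  note [measurable] = quantile_measurable[OF \<mu>]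
  show "real_distribution (\<mu> i)" by (rule real_distribution_belief[OF \<mu>])
  show "real_distribution (distr unit_interval borel (quantile (\<mu> i)))"
    by (rule unit_interval.real_distribution_distr) measurable
  show "cdf (distr unit_interval borel (quantile (\<mu> i))) = cdf (\<mu> i)"
  proof
    fix x
    have eq: "cdf (distr unit_interval borel (quantile (\<mu> i))) x
        = measure unit_interval {t \<in> {0..1}. quantile (\<mu> i) t \<le> x}"
      unfolding cdf_def by (subst measure_distr) (auto intro!: arg_cong[where f = "measure unit_interval"])
    consider "x < 0" | "x \<in> {0..1}" | "1 < x" by fastforce
    then show "cdf (distr unit_interval borel (quantile (\<mu> i))) x = cdf (\<mu> i) x"
    proof cases
      case 1
      then have "\<not> quantile (\<mu> i) t \<le> x" if "t \<in> {0..1}" for t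
        using quantile_in_unit[OF \<mu> that, of i] by simp
      then have empty: "{t \<in> {0..1}. quantile (\<mu> i) t \<le> x} = {}" by blast
      show ?thesis unfolding eq empty using belief_mass_outside(1)[OF \<mu> 1, of i] by (simp add: cdf_def)
    next
      case 2
      have "{t \<in> {0..1}. quantile (\<mu> i) t \<le> x} = {t \<in> {0..1}. t \<le> cdf (\<mu> i) x}"
        using quantile_le_iff[OF \<mu> _ 2] by (auto simp: cdf_def)
      then show ?thesis
        unfolding eq using measure_unit_interval_atMost[of "cdf (\<mu> i) x"]
        by (simp add: \<mu>.cdf_nonneg \<mu>.cdf_bounded_prob)
    next
      case 3
      then have "quantile (\<mu> i) t \<le> x" if "t \<in> {0..1}" for t
        using quantile_in_unit[OF \<mu> that, of i] by simp
      then have full: "{t \<in> {0..1}. quantile (\<mu> i) t \<le> x} = space unit_interval" by auto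
      show ?thesis
        unfolding eq full using belief_mass_outside(2)[OF \<mu>, of x i] 3 unit_interval.prob_space by (simp add: cdf_def)
    qed
  qed
qed

section \<open>Realising a signal by a private private structure\<close>

lemma distr_cube_component: "distr (cube UNIV) unit_interval (\<lambda>x. x i) = unit_interval"
  unfolding cube_def by (rule distr_PiM_component) (auto simp: prob_space_unit_interval)

lemma measurable_cube_component [measurable]: "(\<lambda>x. x i) \<in> cube UNIV \<rightarrow>\<^sub>M unit_interval"
  unfolding cube_def by simp

text \<open>The law of a uniform point of the cube together with a state that equals 1 with
  conditional probability \<open>f\<close>. The densities of the two states add up to 1 at each
  point, so the signals stay uniform and unconditionally independent.\<close>

definition signal_space :: "(('n::finite \<Rightarrow> real) \<Rightarrow> real) \<Rightarrow> (nat \<times> ('n \<Rightarrow> real)) measure" where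
  "signal_space f = density (count_space {0, 1} \<Otimes>\<^sub>M cube UNIV)
     (\<lambda>z. ennreal (if fst z = 1 then f (snd z) else 1 - f (snd z)))"

lemma space_signal_space: "space (signal_space f) = {0, 1} \<times> space (cube UNIV)"
  by (simp add: signal_space_def space_pair_measure)

lemma sets_signal_space [measurable_cong]:
  "sets (signal_space f) = sets (count_space {0, 1} \<Otimes>\<^sub>M cube UNIV)"
  unfolding signal_space_def by (rule sets_density)

lemma nn_integral_signal_space:
  assumes f: "unit_valued f" and h: "h \<in> borel_measurable (count_space {0, 1} \<Otimes>\<^sub>M cube UNIV)"
  shows "(\<integral>\<^sup>+z. h z \<partial>signal_space f)
    = (\<integral>\<^sup>+x. ennreal (1 - f x) * h (0, x) + ennreal (f x) * h (1, x) \<partial>cube UNIV)"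
proof -
  have [measurable]: "f \<in> borel_measurable (cube UNIV)" by (rule unit_valued_measurable[OF f])
  note h[measurable]
  define d where "d z = ennreal (if fst z = (1::nat) then f (snd z) else 1 - f (snd z))" for z
  have d[measurable]: "d \<in> borel_measurable (count_space {0, 1} \<Otimes>\<^sub>M cube UNIV)"
    unfolding d_def by measurable
  have "(\<integral>\<^sup>+z. h z \<partial>signal_space f) = (\<integral>\<^sup>+z. d z * h z \<partial>(count_space {0, 1} \<Otimes>\<^sub>M cube UNIV))"
    unfolding signal_space_def d_def[symmetric] by (rule nn_integral_density) measurable
  also have "\<dots> = (\<integral>\<^sup>+w. \<integral>\<^sup>+x. d (w, x) * h (w, x) \<partial>cube UNIV \<partial>count_space {0, 1})"
    by (subst cube.nn_integral_fst[symmetric]) measurable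
  also have "\<dots> = (\<integral>\<^sup>+x. d (0, x) * h (0, x) \<partial>cube UNIV) + (\<integral>\<^sup>+x. d (1, x) * h (1, x) \<partial>cube UNIV)"
    by (subst nn_integral_count_space_finite) auto
  also have "\<dots> = (\<integral>\<^sup>+x. d (0, x) * h (0, x) + d (1, x) * h (1, x) \<partial>cube UNIV)"
    by (rule nn_integral_add[symmetric]) measurable
  finally show ?thesis by (simp add: d_def)
qed

lemma emeasure_signal_space:
  assumes f: "unit_valued f" and B: "B \<in> sets (cube UNIV)"
  shows "emeasure (signal_space f) ({0, 1} \<times> B) = emeasure (cube UNIV) B"
    and "emeasure (signal_space f) ({1} \<times> B) = (\<integral>\<^sup>+x. ennreal (f x * indicator B x) \<partial>cube UNIV)"
proof -
  have m: "{0, 1} \<times> B \<in> sets (count_space {0, 1::nat} \<Otimes>\<^sub>M cube UNIV)"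
    "{1} \<times> B \<in> sets (count_space {0, 1::nat} \<Otimes>\<^sub>M cube UNIV)"
    using B by auto
  have "emeasure (signal_space f) ({0, 1} \<times> B) = (\<integral>\<^sup>+z. indicator ({0, 1} \<times> B) z \<partial>signal_space f)"
    using m(1) by (subst nn_integral_indicator) (simp_all only: sets_signal_space)
  also have "\<dots> = (\<integral>\<^sup>+x. ennreal (1 - f x) * indicator ({0, 1} \<times> B) (0::nat, x)
      + ennreal (f x) * indicator ({0, 1} \<times> B) (1::nat, x) \<partial>cube UNIV)"
    by (rule nn_integral_signal_space[OF f]) (use m(1) in measurable)
  also have "\<dots> = (\<integral>\<^sup>+x. ennreal (1 - f x) * indicator B x + ennreal (f x) * indicator B x \<partial>cube UNIV)"
    by (intro nn_integral_cong) (auto simp: indicator_def)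
  also have "\<dots> = (\<integral>\<^sup>+x. indicator B x \<partial>cube UNIV)"
  proof (rule nn_integral_cong)
    fix x :: "'a \<Rightarrow> real" assume x: "x \<in> space (cube UNIV)"
    have "ennreal (1 - f x) + ennreal (f x) = 1"
      using unit_valued_bounds[OF f x] by (simp flip: ennreal_plus)
    then show "ennreal (1 - f x) * indicator B x + ennreal (f x) * indicator B x = indicator B x"
      by (metis distrib_right mult_1)
  qed
  finally show "emeasure (signal_space f) ({0, 1} \<times> B) = emeasure (cube UNIV) B"
    using B by simp
  show "emeasure (signal_space f) ({1} \<times> B) = (\<integral>\<^sup>+x. ennreal (f x * indicator B x) \<partial>cube UNIV)"
  proof -
    have "emeasure (signal_space f) ({1} \<times> B) = (\<integral>\<^sup>+z. indicator ({1} \<times> B) z \<partial>signal_space f)"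
      using m(2) by (subst nn_integral_indicator) (simp_all only: sets_signal_space)
    also have "\<dots> = (\<integral>\<^sup>+x. ennreal (1 - f x) * indicator ({1} \<times> B) (0::nat, x)
        + ennreal (f x) * indicator ({1} \<times> B) (1::nat, x) \<partial>cube UNIV)"
      by (rule nn_integral_signal_space[OF f]) (use m(2) in measurable)
    also have "\<dots> = (\<integral>\<^sup>+x. ennreal (f x * indicator B x) \<partial>cube UNIV)"
      by (intro nn_integral_cong) (auto simp: indicator_def)
    finally show ?thesis .
  qed
qed

lemma prob_space_signal_space:
  assumes "unit_valued f"
  shows "prob_space (signal_space f)"
  by (rule prob_spaceI)
     (use emeasure_signal_space(1)[OF assms sets.top] cube.emeasure_space_1 in \<open>simp add: space_signal_space\<close>)

lemma distr_signal_space_snd: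
  assumes "unit_valued f"
  shows "distr (signal_space f) (cube UNIV) snd = cube UNIV"
proof (rule measure_eqI)
  fix B assume "B \<in> sets (distr (signal_space f) (cube UNIV) snd)"
  then have B: "B \<in> sets (cube UNIV)" by simp
  have "snd -` B \<inter> space (signal_space f) = {0, 1} \<times> B"
    using sets.sets_into_space[OF B] by (auto simp: space_signal_space)
  then show "emeasure (distr (signal_space f) (cube UNIV) snd) B = emeasure (cube UNIV) B"
    using B emeasure_signal_space(1)[OF assms B] by (subst emeasure_distr) auto
qed simp

lemma measure_signal_space_state:
  assumes f: "unit_valued f" and B: "B \<in> sets (cube UNIV)"
  shows "measure (signal_space f) ({1} \<times> B) = (\<integral>x. f x * indicator B x \<partial>cube UNIV)"
proof -
  have [measurable]: "f \<in> borel_measurable (cube UNIV)" by (rule unit_valued_measurable[OF f])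
  note B[measurable]
  have "(\<integral>x. f x * indicator B x \<partial>cube UNIV) = enn2real (\<integral>\<^sup>+x. ennreal (f x * indicator B x) \<partial>cube UNIV)"
    by (rule integral_eq_nn_integral) (use unit_valued_bounds[OF f] in \<open>auto intro!: AE_I2\<close>)
  then show ?thesis using emeasure_signal_space(2)[OF f B] by (simp add: measure_def)
qed

lemma sigma_finite_subalgebra_vimage:
  assumes "prob_space M" "s \<in> M \<rightarrow>\<^sub>M S"
  shows "sigma_finite_subalgebra M (vimage_algebra (space M) s S)"
proof (rule finite_measure_subalgebra_is_sigma_finite)
  interpret prob_space M by fact
  show "finite_measure_subalgebra M (vimage_algebra (space M) s S)"
    by standard (use assms(2) in \<open>auto simp: subalgebra_def measurable_iff_sets\<close>)
qed

text \<open>The joint law of the signals is that of the cube, a product, whence independence. The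
  marginal is recognised as the posterior by testing it on the events that signal \<open>i\<close>
  falls into a set \<open>B\<close>.\<close>

lemma signal_realisation:
  fixes f :: "('n::finite \<Rightarrow> real) \<Rightarrow> real"
  assumes f: "unit_valued f" and p: "(\<integral>x. f x \<partial>cube UNIV) = p"
  shows "private_private p (signal_space f) fst (\<lambda>_. unit_interval) (\<lambda>i z. snd z i)"
    and "AE z in signal_space f. posterior (signal_space f) fst (\<lambda>_. unit_interval) (\<lambda>i z. snd z i) i z
      = marginal f i (snd z i)"
proof -
  interpret S: prob_space "signal_space f" by (rule prob_space_signal_space[OF f])
  have [measurable]: "f \<in> borel_measurable (cube UNIV)" by (rule unit_valued_measurable[OF f])
  have snd_m [measurable]: "snd \<in> signal_space f \<rightarrow>\<^sub>M cube UNIV" by measurable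
  have s: "(\<lambda>z. snd z i) \<in> signal_space f \<rightarrow>\<^sub>M unit_interval" for i by measurable
  have fst_m: "fst \<in> signal_space f \<rightarrow>\<^sub>M count_space {0, 1}" by measurable
  have E: "{z \<in> space (signal_space f). fst z = 1} = {1} \<times> space (cube UNIV)"
    by (auto simp: space_signal_space)
  have "S.prob {z \<in> space (signal_space f). fst z = 1} = (\<integral>x. f x * indicator (space (cube UNIV)) x \<partial>cube UNIV)"
    unfolding E by (rule measure_signal_space_state[OF f sets.top])
  also have "\<dots> = p"
    unfolding p[symmetric] by (rule Bochner_Integration.integral_cong) auto
  finally have prior: "S.prob {z \<in> space (signal_space f). fst z = 1} = p" .
  have coord: "distr (signal_space f) unit_interval (\<lambda>z. snd z i) = unit_interval" for i
  proof -
    have "distr (signal_space f) unit_interval (\<lambda>z. snd z i)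
        = distr (distr (signal_space f) (cube UNIV) snd) unit_interval (\<lambda>x. x i)"
      by (subst distr_distr) (auto simp: o_def)
    then show ?thesis by (simp add: distr_signal_space_snd[OF f] distr_cube_component)
  qed
  have "S.indep_vars (\<lambda>_. unit_interval) (\<lambda>i z. snd z i) UNIV"
  proof (subst S.indep_vars_iff_distr_eq_PiM)
    have "distr (signal_space f) (Pi\<^sub>M UNIV (\<lambda>_. unit_interval)) (\<lambda>z. \<lambda>i\<in>UNIV. snd z i)
        = distr (signal_space f) (cube UNIV) snd"
      by (simp add: cube_def restrict_def)
    also have "\<dots> = Pi\<^sub>M UNIV (\<lambda>i. distr (signal_space f) unit_interval (\<lambda>z. snd z i))"
      unfolding distr_signal_space_snd[OF f] coord by (simp add: cube_def)
    finally show "distr (signal_space f) (Pi\<^sub>M UNIV (\<lambda>_. unit_interval)) (\<lambda>z. \<lambda>i\<in>UNIV. snd z i)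
        = Pi\<^sub>M UNIV (\<lambda>i. distr (signal_space f) unit_interval (\<lambda>z. snd z i))" .
  qed (use s in auto)
  then show "private_private p (signal_space f) fst (\<lambda>_. unit_interval) (\<lambda>i z. snd z i)"
    unfolding private_private_def information_structure_def
    using S.prob_space_axioms fst_m prior s by auto
  let ?F = "vimage_algebra (space (signal_space f)) (\<lambda>z. snd z i) unit_interval"
  interpret F: sigma_finite_subalgebra "signal_space f" ?F
    by (rule sigma_finite_subalgebra_vimage[OF S.prob_space_axioms s])
  have mm [measurable]: "marginal f i \<in> borel_measurable unit_interval"
    using unit_valued_integrable_marginal[OF f] by (rule borel_measurable_integrable)
  have gm: "(\<lambda>z. marginal f i (snd z i)) \<in> borel_measurable ?F"
    by (rule measurable_compose[OF measurable_vimage_algebra1 mm])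
       (use s[THEN measurable_space] in auto)
  have gi: "integrable (signal_space f) (\<lambda>z. marginal f i (snd z i))"
    by (rule integrable_distr[OF s]) (simp add: coord unit_valued_integrable_marginal[OF f])
  show "AE z in signal_space f. posterior (signal_space f) fst (\<lambda>_. unit_interval) (\<lambda>i z. snd z i) i z
      = marginal f i (snd z i)"
    unfolding posterior_def
  proof (rule F.real_cond_exp_charact[OF _ _ gi gm])
    show "integrable (signal_space f) (indicator {w \<in> space (signal_space f). fst w = 1} :: _ \<Rightarrow> real)"
      unfolding E by (rule integrable_real_indicator) (auto simp: sets_signal_space less_top[symmetric])
    fix A assume "A \<in> sets ?F"
    then obtain B where B: "B \<in> sets unit_interval" and A: "A = (\<lambda>z. snd z i) -` B \<inter> space (signal_space f)"
      using s[THEN measurable_space] by (subst (asm) sets_vimage_algebra2) auto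
    note B[measurable]
    define C where "C = (\<lambda>x. x i) -` B \<inter> space (cube (UNIV :: 'n set))"
    have C: "C \<in> sets (cube UNIV)" unfolding C_def by measurable
    have AE: "A \<inter> {w \<in> space (signal_space f). fst w = 1} = {1} \<times> C"
      by (auto simp: A C_def space_signal_space)
    have "(\<integral>z\<in>A. indicator {w \<in> space (signal_space f). fst w = 1} z \<partial>signal_space f)
        = (\<integral>z. indicator ({1} \<times> C) z \<partial>signal_space f)"
      unfolding set_lebesgue_integral_def AE[symmetric]
      by (rule Bochner_Integration.integral_cong) (auto simp: indicator_def)
    also have "\<dots> = measure (signal_space f) ({1} \<times> C)"
      using C by simp
    also have "\<dots> = (\<integral>x. f x * indicator C x \<partial>cube UNIV)"
      by (rule measure_signal_space_state[OF f C])
    also have "\<dots> = (\<integral>x. f x * indicator B (x i) \<partial>cube UNIV)"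
      by (rule Bochner_Integration.integral_cong) (auto simp: C_def indicator_def)
    \<comment> \<open>With coordinate \<open>i\<close> integrated last, the indicator of
      \<open>B\<close> leaves the inner integral, which becomes the marginal.\<close>
    also have "\<dots> = (\<integral>t. (\<integral>x. f (x(i := t)) * indicator B ((x(i := t)) i) \<partial>cube (UNIV - {i})) \<partial>unit_interval)"
      by (rule cube_Fubini(2)[where B = 1, symmetric])
         (use unit_valued_bounds[OF f] in \<open>auto simp: indicator_def\<close>)
    also have "\<dots> = (\<integral>t. marginal f i t * indicator B t \<partial>unit_interval)"
      by (simp add: marginal_def)
    also have "\<dots> = (\<integral>z. marginal f i (snd z i) * indicator B (snd z i) \<partial>signal_space f)"
      by (subst coord[of i, symmetric], rule integral_distr[OF s]) measurable
    also have "\<dots> = (\<integral>z\<in>A. marginal f i (snd z i) \<partial>signal_space f)"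
      unfolding set_lebesgue_integral_def
      by (rule Bochner_Integration.integral_cong) (auto simp: A indicator_def)
    finally show "(\<integral>z\<in>A. indicator {w \<in> space (signal_space f). fst w = 1} z \<partial>signal_space f)
        = (\<integral>z\<in>A. marginal f i (snd z i) \<partial>signal_space f)" .
  qed
qed

text \<open>Equality of L1 classes means equality a.e., and this suffices because only laws are
  compared.\<close>

lemma feasible_if_quantiles_are_marginals:
  fixes f :: "('n::finite \<Rightarrow> real) \<Rightarrow> real"
  assumes \<mu>: "belief_distribution \<mu>" and f: "f \<in> signals p" and q: "quantile_tuple \<mu> = marginals f"
  shows "feasible_privately TYPE(nat \<times> ('n \<Rightarrow> real)) TYPE(real) p \<mu>"
proof -
  have fu: "unit_valued f" and fp: "(\<integral>x. f x \<partial>cube UNIV) = p"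
    using f by (auto simp: signals_eq)
  let ?M = "signal_space f" and ?s = "\<lambda>i z. snd z i"
  have "distr ?M borel (posterior ?M fst (\<lambda>_. unit_interval) ?s i) = \<mu> i" for i
  proof -
    have [measurable]: "f \<in> borel_measurable (cube UNIV)" by (rule unit_valued_measurable[OF fu])
    have [measurable]: "marginal f i \<in> borel_measurable unit_interval"
      using unit_valued_integrable_marginal[OF fu] by (rule borel_measurable_integrable)
    have s: "(\<lambda>z. snd z i) \<in> ?M \<rightarrow>\<^sub>M unit_interval" by measurable
    have "L1_class (quantile (\<mu> i)) = L1_class (marginal f i)"
      using q by (simp add: quantile_tuple_def marginals_def vec_eq_iff)
    then have eq: "AE t in unit_interval. quantile (\<mu> i) t = marginal f i t"
      by (simp add: L1_class_eq_iff quantile_integrable[OF \<mu>] unit_valued_integrable_marginal[OF fu])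
    have "distr ?M borel (posterior ?M fst (\<lambda>_. unit_interval) ?s i)
        = distr ?M borel (\<lambda>z. marginal f i (snd z i))"
      by (rule distr_cong_AE[OF refl refl signal_realisation(2)[OF fu fp]])
         (auto simp: posterior_def)
    also have "\<dots> = distr (distr ?M unit_interval (\<lambda>z. snd z i)) borel (marginal f i)"
      using s by (subst distr_distr) (auto simp: o_def)
    also have "distr ?M unit_interval (\<lambda>z. snd z i)
        = distr (distr ?M (cube UNIV) snd) unit_interval (\<lambda>x. x i)"
      by (subst distr_distr) (auto simp: o_def)
    also have "\<dots> = unit_interval" by (simp add: distr_signal_space_snd[OF fu] distr_cube_component)
    also have "distr unit_interval borel (marginal f i) = distr unit_interval borel (quantile (\<mu> i))"
      by (rule distr_cong_AE) (use eq quantile_measurable[OF \<mu>] in auto)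
    finally show ?thesis by (simp add: distr_quantile[OF \<mu>])
  qed
  then show ?thesis
    unfolding feasible_privately_def using signal_realisation(1)[OF fu fp] by blast
qed

section \<open>Monotone rearrangement on a grid\<close>

text \<open>\<open>m l j\<close> is the mass of cell \<open>j\<close> of coordinate
  \<open>l\<close>, and independence gives a box the product of its cell masses. The sum is not
  divided by \<open>m i j\<close>, which may vanish; comparisons of slab averages are therefore
  stated multiplied out.\<close>

definition slab_sum ::
  "nat \<Rightarrow> ('n::finite \<Rightarrow> nat \<Rightarrow> real) \<Rightarrow> (('n \<Rightarrow> nat) \<Rightarrow> real) \<Rightarrow> 'n \<Rightarrow> nat \<Rightarrow> real" where
  "slab_sum L m b i j = (\<Sum>k | (\<forall>l. k l \<le> L) \<and> k i = j. (\<Prod>l\<in>UNIV. m l (k l)) * b k)"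

lemma finite_grid: "finite {k :: 'n::finite \<Rightarrow> nat. \<forall>l. k l \<le> L}"
proof -
  have "{k :: 'n \<Rightarrow> nat. \<forall>l. k l \<le> L} = PiE UNIV (\<lambda>_. {..L})" by (auto simp: PiE_def Pi_def)
  then show ?thesis by (simp add: finite_PiE)
qed

lemma finite_slab: "finite {k :: 'n::finite \<Rightarrow> nat. (\<forall>l. k l \<le> L) \<and> P k}"
  by (rule finite_subset[OF _ finite_grid[of L]]) auto

text \<open>If no parallel edge of positive weight increased, averaging over all edges between the
  slabs \<open>j\<close> and \<open>j'\<close> would make the average of slab \<open>j'\<close>
  strictly smaller, thanks to the edge at \<open>k\<close>. That contradicts the hypothesis on the
  slab averages.\<close>

lemma slab_opposite_step:
  fixes m :: "'n::finite \<Rightarrow> nat \<Rightarrow> real"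
  assumes m: "\<And>i j. 0 \<le> m i j"
    and slab: "m i j' * slab_sum L m b i j \<le> m i j * slab_sum L m b i j'"
    and j: "j \<noteq> j'" "j' \<le> L"
    and k: "\<forall>l. k l \<le> L" "k i = j" "\<And>l. 0 < m l (k l)" "0 < m i j'"
    and bk: "b (k(i := j')) < b k"
  shows "\<exists>y. (\<forall>l. y l \<le> L) \<and> y i = j \<and> (\<forall>l. 0 < m l (y l)) \<and> b y < b (y(i := j'))"
proof (rule ccontr)
  assume "\<not> ?thesis"
  then have no: "b (y(i := j')) \<le> b y" if "\<forall>l. y l \<le> L" "y i = j" "\<forall>l. 0 < m l (y l)" for y
    using that by force
  define S where "S = {y. (\<forall>l. y l \<le> L) \<and> y i = j}"
  \<comment> \<open>The weight without its factor at \<open>i\<close>, common to both ends of an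
    edge in direction \<open>i\<close>.\<close>
  define u where "u y = (\<Prod>l\<in>UNIV - {i}. m l (y l))" for y
  have mj: "0 < m i j" using k(2,3) by metis
  have jL: "j \<le> L" using k by auto
  have prod_u: "(\<Prod>l\<in>UNIV. m l (y l)) = m i (y i) * u y" for y
    unfolding u_def by (rule prod.remove) auto
  have u_upd: "u (y(i := v)) = u y" for y v
    unfolding u_def by (rule prod.cong) auto
  have 1: "slab_sum L m b i j = m i j * (\<Sum>y\<in>S. u y * b y)"
    unfolding slab_sum_def S_def sum_distrib_left by (rule sum.cong) (auto simp: prod_u)
  have "inj_on (\<lambda>y. y(i := j')) S"
    by (rule inj_on_inverseI[where g = "\<lambda>y. y(i := j)"]) (auto simp: S_def)
  moreover have "{y. (\<forall>l. y l \<le> L) \<and> y i = j'} = (\<lambda>y. y(i := j')) ` S"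
  proof (intro equalityI subsetI)
    fix y assume y: "y \<in> {y. (\<forall>l. y l \<le> L) \<and> y i = j'}"
    then have "y = (y(i := j))(i := j')" by auto
    moreover have "y(i := j) \<in> S" using y jL by (auto simp: S_def)
    ultimately show "y \<in> (\<lambda>y. y(i := j')) ` S" by (rule image_eqI)
  qed (use j in \<open>auto simp: S_def\<close>)
  ultimately have "slab_sum L m b i j' = (\<Sum>y\<in>S. (\<Prod>l\<in>UNIV. m l ((y(i := j')) l)) * b (y(i := j')))"
    unfolding slab_sum_def by (simp only: sum.reindex o_def)
  also have "\<dots> = m i j' * (\<Sum>y\<in>S. u y * b (y(i := j')))"
    unfolding sum_distrib_left prod_u u_upd by (rule sum.cong) auto
  finally have 2: "slab_sum L m b i j' = m i j' * (\<Sum>y\<in>S. u y * b (y(i := j')))" .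
  have "(\<Sum>y\<in>S. u y * b (y(i := j'))) < (\<Sum>y\<in>S. u y * b y)"
  proof (rule sum_strict_mono_ex1)
    show "finite S" unfolding S_def by (rule finite_slab)
    have "u k * b (k(i := j')) < u k * b k"
      using bk k(3) by (auto simp: u_def intro!: mult_strict_left_mono prod_pos)
    then show "\<exists>y\<in>S. u y * b (y(i := j')) < u y * b y"
      using k by (auto simp: S_def)
    show "\<forall>y\<in>S. u y * b (y(i := j')) \<le> u y * b y"
    proof
      fix y assume y: "y \<in> S"
      show "u y * b (y(i := j')) \<le> u y * b y"
      proof (cases "\<forall>l\<in>UNIV - {i}. 0 < m l (y l)")
        case True
        then have "\<forall>l. 0 < m l (y l)" using mj y unfolding S_def by auto
        then show ?thesis
          using no[of y] y m by (auto simp: S_def u_def intro!: mult_left_mono prod_nonneg)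
      next
        case False
        then have "u y = 0" using m by (auto simp: u_def less_le)
        then show ?thesis by simp
      qed
    qed
  qed
  then have "m i j * m i j' * (\<Sum>y\<in>S. u y * b (y(i := j'))) < m i j * m i j' * (\<Sum>y\<in>S. u y * b y)"
    using mj k(4) by (intro mult_strict_left_mono) auto
  then show False
    using slab unfolding 1 2 by (simp add: mult_ac)
qed

text \<open>
  The rearrangement minimises the weighted sum of squares among all \<open>b\<close> with the given slab sums.
  If it decreased along some coordinate, monotonicity of the slab averages would provide a parallel
  edge along which it increases, and shifting mass around the resulting rectangle would lower the
  sum of squares.
\<close>

lemma monotone_rearrangement:
  fixes m :: "'n::finite \<Rightarrow> nat \<Rightarrow> real" and a :: "('n \<Rightarrow> nat) \<Rightarrow> real"
  assumes m: "\<And>i j. 0 \<le> m i j"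
    and a: "\<And>k. 0 \<le> a k" "\<And>k. a k \<le> 1"
    and slab: "\<And>i j j'. j < j' \<Longrightarrow> j' \<le> L \<Longrightarrow> 0 < m i j \<Longrightarrow> 0 < m i j' \<Longrightarrow>
      m i j' * slab_sum L m a i j \<le> m i j * slab_sum L m a i j'"
  obtains b where "\<And>k. 0 \<le> b k" "\<And>k. b k \<le> 1"
    "\<And>i j. slab_sum L m b i j = slab_sum L m a i j"
    "\<And>k k'. k \<le> k' \<Longrightarrow> (\<And>l. k' l \<le> L) \<Longrightarrow> (\<And>l. 0 < m l (k l)) \<Longrightarrow> (\<And>l. 0 < m l (k' l)) \<Longrightarrow> b k \<le> b k'"
proof -
  define G where "G = {k :: 'n \<Rightarrow> nat. \<forall>l. k l \<le> L}"
  have G: "finite G" unfolding G_def by (rule finite_grid)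
  define w where "w k = (\<Prod>l\<in>UNIV. m l (k l))" for k :: "'n \<Rightarrow> nat"
  define C where "C = PiE UNIV (\<lambda>_. {0..1}) \<inter>
    (\<Inter>i. \<Inter>j. {b. slab_sum L m b i j = slab_sum L m a i j})"
  define Q where "Q b = (\<Sum>k\<in>G. w k * (b k)\<^sup>2)" for b
  have coord: "continuous_on A (\<lambda>b. b k)" for A :: "(('n \<Rightarrow> nat) \<Rightarrow> real) set" and k
    by (rule continuous_on_subset[OF continuous_on_product_coordinates]) simp
  have cont: "continuous_on A (\<lambda>b. slab_sum L m b i j)" for A i j
    unfolding slab_sum_def by (intro continuous_on_sum continuous_on_mult continuous_on_const coord)
  \<comment> \<open>Tables are indexed by all tuples of naturals, infinitely many, so compactness is
    Tychonoff's theorem.\<close>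
  have "compactin (product_topology (\<lambda>_. euclidean) UNIV) (PiE UNIV (\<lambda>_ :: 'n \<Rightarrow> nat. {0..1 :: real}))"
    by (simp add: compactin_PiE)
  then have "compact (PiE UNIV (\<lambda>_ :: 'n \<Rightarrow> nat. {0..1 :: real}))"
    by (simp add: euclidean_product_topology)
  then have "compact C"
    unfolding C_def
    by (intro compact_Int_closed closed_INT ballI closed_Collect_eq cont continuous_on_const)
  moreover have "a \<in> C" using a by (simp add: C_def PiE_def Pi_def)
  then have "C \<noteq> {}" by blast
  moreover have "continuous_on C Q"
    unfolding Q_def by (intro continuous_on_sum continuous_on_mult continuous_on_const continuous_on_power coord)
  ultimately obtain b where b: "b \<in> C" and min: "\<And>c. c \<in> C \<Longrightarrow> Q b \<le> Q c"
    using continuous_attains_inf[of C Q] by blast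
  have b01: "0 \<le> b k" "b k \<le> 1" for k using b by (auto simp: C_def PiE_def Pi_def)
  have bslab: "slab_sum L m b i j = slab_sum L m a i j" for i j using b by (auto simp: C_def)
  have step: "b k \<le> b (k(i := j'))"
    if k: "k \<in> G" "\<And>l. 0 < m l (k l)" and j': "k i < j'" "j' \<le> L" "0 < m i j'" for k i j'
  proof (rule ccontr)
    assume "\<not> ?thesis"
    then have bk: "b (k(i := j')) < b k" by simp
    have "\<exists>y. (\<forall>l. y l \<le> L) \<and> y i = k i \<and> (\<forall>l. 0 < m l (y l)) \<and> b y < b (y(i := j'))"
      by (rule slab_opposite_step[OF m, where k = k])
         (use k j' bk slab[of "k i" j' i] in \<open>auto simp: bslab G_def\<close>)
    then obtain y where y: "\<And>l. y l \<le> L" "y i = k i" "\<And>l. 0 < m l (y l)" and b_y: "b y < b (y(i := j'))"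
      by blast
    define k' y' where "k' = k(i := j')" and "y' = y(i := j')"
    \<comment> \<open>Mass moves from \<open>k\<close> up to \<open>k'\<close> and, to compensate,
      from \<open>y'\<close> down to \<open>y\<close>. Dividing by the weight turns this transfer of
      mass into the change \<open>e\<close> of the table.\<close>
    define \<sigma> :: "('n \<Rightarrow> nat) \<Rightarrow> real" where
      "\<sigma> x = of_bool (x = k') - of_bool (x = k) + of_bool (x = y) - of_bool (x = y')" for x
    define e where "e x = \<sigma> x / w x" for x
    have w0: "0 \<le> w x" for x unfolding w_def by (intro prod_nonneg) (use m in auto)
    have pos: "0 < w k" "0 < w k'" "0 < w y" "0 < w y'"
      unfolding w_def k'_def y'_def by (intro prod_pos; use k y j' in auto)+
    have we: "w x * e x = \<sigma> x" for x
      using pos by (auto simp: e_def \<sigma>_def)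
    have inG: "k \<in> G" "k' \<in> G" "y \<in> G" "y' \<in> G"
      using k y j' by (auto simp: G_def k'_def y'_def)
    have sum_delta: "(\<Sum>x\<in>A. \<sigma> x * c x) = of_bool (k' \<in> A) * c k' - of_bool (k \<in> A) * c k
        + of_bool (y \<in> A) * c y - of_bool (y' \<in> A) * c y'" if "finite A" for A c
    proof -
      have "of_bool (x = z) * c x = (if z = x then c z else 0)" for x z by simp
      then have "(\<Sum>x\<in>A. of_bool (x = z) * c x) = of_bool (z \<in> A) * c z" for z
        using that by simp
      then show ?thesis
        by (simp add: \<sigma>_def algebra_simps sum.distrib sum_subtractf)
    qed
    have slab_e: "slab_sum L m (\<lambda>x. b x + \<epsilon> * e x) i' j = slab_sum L m b i' j" for \<epsilon> i' j
    proof -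
      let ?A = "{x. (\<forall>l. x l \<le> L) \<and> x i' = j}"
      \<comment> \<open>In direction \<open>i\<close> each affected slab contains one gaining and
        one losing corner: \<open>y\<close> and \<open>k\<close>, or \<open>k'\<close> and
        \<open>y'\<close>. In any other direction the two ends of each edge share a slab.\<close>
      have "(\<Sum>x\<in>?A. \<sigma> x * 1) = 0"
        unfolding sum_delta[OF finite_slab] using inG y(2) by (auto simp: G_def k'_def y'_def)
      then have "(\<Sum>x\<in>?A. w x * (\<epsilon> * e x)) = 0"
        by (simp add: mult.left_commute[of _ \<epsilon>] we flip: sum_distrib_left)
      then show ?thesis
        unfolding slab_sum_def w_def[symmetric] by (simp add: distrib_left sum.distrib)
    qed
    have "\<forall>\<^sub>F \<epsilon> in at_right 0. 0 \<le> b x + \<epsilon> * e x \<and> b x + \<epsilon> * e x \<le> 1" for x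
    proof -
      have lim: "((\<lambda>\<epsilon>. b x + \<epsilon> * e x) \<longlongrightarrow> b x) (at_right 0)"
        by (auto intro!: tendsto_eq_intros)
      have p: "\<forall>\<^sub>F \<epsilon> in at_right (0::real). 0 < \<epsilon>" by (simp add: eventually_at_right_less)
      \<comment> \<open>A small change leaves [0,1] only by raising a 1 or lowering a 0. The raised
        corners \<open>k'\<close> and \<open>y\<close> have smaller values than \<open>k\<close> and
        \<open>y'\<close>, hence less than 1; the lowered ones are likewise positive.\<close>
      consider "e x = 0" | "e x > 0" "b x < 1" | "e x < 0" "0 < b x"
      proof -
        have "e x > 0 \<Longrightarrow> x = k' \<or> x = y" "e x < 0 \<Longrightarrow> x = k \<or> x = y'"
          using w0[of x] by (auto simp: e_def \<sigma>_def of_bool_def zero_less_divide_iff divide_less_0_iff split: if_splits)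
        moreover have "b k' < 1" "b y < 1" "0 < b k" "0 < b y'"
          using bk b_y b01(2)[of k] b01(2)[of y'] b01(1)[of k'] b01(1)[of y]
          unfolding k'_def y'_def by linarith+
        ultimately show ?thesis using that by (metis linorder_cases)
      qed
      then show ?thesis
      proof cases
        case 1 then show ?thesis using b01 by simp
      next
        case 2
        show ?thesis
          using order_tendstoD(2)[OF lim 2(2)] p
          by eventually_elim (use 2 b01(1)[of x] in \<open>auto intro!: add_nonneg_nonneg\<close>)
      next
        case 3
        show ?thesis
          using order_tendstoD(1)[OF lim 3(2)] p
        proof eventually_elim
          case (elim \<epsilon>)
          then have "\<epsilon> * e x \<le> 0" using 3 by (simp add: mult_nonneg_nonpos)
          then show ?case using elim b01(2)[of x] by linarith
        qed
      qed
    qed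
    then have E1: "\<forall>\<^sub>F \<epsilon> in at_right 0. \<forall>x\<in>{k, k', y, y'}. 0 \<le> b x + \<epsilon> * e x \<and> b x + \<epsilon> * e x \<le> 1"
      by (intro eventually_ball_finite) auto
    \<comment> \<open>First- and second-order terms: moving by \<open>\<epsilon>\<close> changes
      \<open>Q\<close> by \<open>\<epsilon> * (2 * S + \<epsilon> * T)\<close>. Both edges
      contribute a negative difference to \<open>S\<close>.\<close>
    define S T where "S = (\<Sum>x\<in>G. \<sigma> x * b x)" and "T = (\<Sum>x\<in>G. w x * (e x)\<^sup>2)"
    have "S < 0" unfolding S_def sum_delta[OF G] using inG bk b_y by (simp add: k'_def y'_def)
    have "((\<lambda>\<epsilon>. 2 * S + \<epsilon> * T) \<longlongrightarrow> 2 * S) (at_right 0)"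
      by (auto intro!: tendsto_eq_intros)
    then have E2: "\<forall>\<^sub>F \<epsilon> in at_right 0. 2 * S + \<epsilon> * T < 0"
      using \<open>S < 0\<close> by (auto dest!: order_tendstoD(2)[where a = 0])
    have E3: "\<forall>\<^sub>F \<epsilon> in at_right (0::real). 0 < \<epsilon>" by (simp add: eventually_at_right_less)
    have "\<forall>\<^sub>F \<epsilon> in at_right 0. 0 < \<epsilon> \<and> 2 * S + \<epsilon> * T < 0 \<and>
        (\<forall>x\<in>{k, k', y, y'}. 0 \<le> b x + \<epsilon> * e x \<and> b x + \<epsilon> * e x \<le> 1)"
      using E1 E2 E3 by eventually_elim auto
    then obtain \<epsilon> where \<epsilon>: "0 < \<epsilon>" "2 * S + \<epsilon> * T < 0"
        "\<And>x. x \<in> {k, k', y, y'} \<Longrightarrow> 0 \<le> b x + \<epsilon> * e x \<and> b x + \<epsilon> * e x \<le> 1"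
      using eventually_happens'[OF trivial_limit_at_right_real] by blast
    have "(\<lambda>x. b x + \<epsilon> * e x) \<in> C"
      unfolding C_def
    proof (intro IntI INT_I CollectI)
      have "0 \<le> b x + \<epsilon> * e x \<and> b x + \<epsilon> * e x \<le> 1" for x
      proof (cases "x \<in> {k, k', y, y'}")
        case False
        then have "e x = 0" by (simp add: e_def \<sigma>_def)
        then show ?thesis using b01 by simp
      qed (use \<epsilon>(3) in blast)
      then show "(\<lambda>x. b x + \<epsilon> * e x) \<in> PiE UNIV (\<lambda>_. {0..1})" by (auto simp: PiE_def Pi_def)
    qed (simp add: slab_e bslab)
    from min[OF this] have "Q b \<le> Q (\<lambda>x. b x + \<epsilon> * e x)" .
    also have "Q (\<lambda>x. b x + \<epsilon> * e x) = Q b + \<epsilon> * (2 * S + \<epsilon> * T)"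
    proof -
      have "w x * (b x + \<epsilon> * e x)\<^sup>2 = w x * (b x)\<^sup>2 + \<epsilon> * (2 * (w x * e x * b x) + \<epsilon> * (w x * (e x)\<^sup>2))" for x
        by (simp add: power2_eq_square algebra_simps)
      then show ?thesis
        unfolding Q_def S_def T_def we
        by (simp add: sum.distrib sum_distrib_left distrib_left)
    qed
    finally show False using \<epsilon>(1,2) by (simp add: mult_pos_neg not_le zero_le_mult_iff)
  qed
  show ?thesis
  proof (rule that[of b])
    fix k k' :: "'n \<Rightarrow> nat"
    assume kk': "k \<le> k'" and L: "\<And>l. k' l \<le> L" and pos: "\<And>l. 0 < m l (k l)" "\<And>l. 0 < m l (k' l)"
    \<comment> \<open>The path from \<open>k\<close> to \<open>k'\<close> changes one coordinate at
      a time. Its intermediate tuples use only cells of \<open>k\<close> or \<open>k'\<close>, so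
      all of them have positive mass.\<close>
    have "b k \<le> b (\<lambda>l. if l \<in> A then k' l else k l)" if "finite A" for A
      using that
    proof induction
      case (insert i A)
      let ?h = "\<lambda>l. if l \<in> A then k' l else k l"
      have "?h l \<le> L" for l using L[of l] kk'[THEN le_funD, of l] by auto
      then have "?h \<in> G" by (simp add: G_def)
      moreover have "(\<lambda>l. if l \<in> insert i A then k' l else k l) = ?h(i := k' i)" by auto
      moreover have "?h i = k i" using insert by simp
      ultimately have "b ?h \<le> b (\<lambda>l. if l \<in> insert i A then k' l else k l)"
        using step[of ?h i "k' i"] pos L[of i] kk'[THEN le_funD, of i]
        by (cases "k i = k' i") (auto simp: fun_upd_idem)
      then show ?case using insert by simp
    qed simp
    from this[of UNIV] show "b k \<le> b k'" by simp
  qed (use b01 bslab in auto)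
qed

section \<open>Rounding the posteriors to a grid\<close>

text \<open>Clamping gives every real a cell among \<open>0..N\<close>; for positive
  \<open>N\<close> the last one catches the belief 1. Thus there are \<open>N + 1\<close>
  cells.\<close>

definition cell :: "nat \<Rightarrow> real \<Rightarrow> nat" where
  "cell N x = nat \<lfloor>real N * min 1 x\<rfloor>"

lemma cell_le: "cell N x \<le> N"
proof -
  have "real N * min 1 x \<le> real N * 1" by (intro mult_left_mono) auto
  then show ?thesis unfolding cell_def by linarith
qed

lemma cell_mono: "x \<le> y \<Longrightarrow> cell N x \<le> cell N y"
  unfolding cell_def by (intro nat_mono floor_mono mult_left_mono min.mono) auto

lemma cell_bounds:
  assumes "0 < N" "x \<in> {0..1}"
  shows "real (cell N x) / N \<le> x" "x \<le> (real (cell N x) + 1) / N"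
proof -
  have "min 1 x = x" "0 \<le> real N * x" using assms by auto
  then have "real (cell N x) = of_int \<lfloor>real N * x\<rfloor>" by (simp add: cell_def)
  then have "real (cell N x) \<le> real N * x" "real N * x \<le> real (cell N x) + 1"
    by linarith+
  then show "real (cell N x) / N \<le> x" "x \<le> (real (cell N x) + 1) / N"
    using assms(1) by (auto simp: field_simps)
qed

lemma cell_measurable [measurable]: "cell N \<in> borel \<rightarrow>\<^sub>M count_space UNIV"
  unfolding cell_def by measurable

definition cell_mass :: "nat \<Rightarrow> ('n \<Rightarrow> real measure) \<Rightarrow> 'n \<Rightarrow> nat \<Rightarrow> real" where
  "cell_mass N \<mu> i j = measure (\<mu> i) {x. cell N x = j}"

text \<open>A partial mean, not divided by the mass. For beliefs coming from a private structure it
  is the probability of state 1 jointly with a belief in the cell.\<close>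

definition cell_mean :: "nat \<Rightarrow> ('n \<Rightarrow> real measure) \<Rightarrow> 'n \<Rightarrow> nat \<Rightarrow> real" where
  "cell_mean N \<mu> i j = (\<integral>x. x * of_bool (cell N x = j) \<partial>\<mu> i)"

lemma AE_belief: "belief_distribution \<mu> \<Longrightarrow> AE x in \<mu> i. x \<in> {0..1}"
proof -
  assume \<mu>: "belief_distribution \<mu>"
  interpret prob_space "\<mu> i" using \<mu> by (simp add: belief_distribution_def)
  show ?thesis
    using \<mu> AE_prob_1[of "{0..1}"] by (simp add: belief_distribution_def)
qed

lemma cell_mean_bounds:
  assumes \<mu>: "belief_distribution \<mu>" and N: "0 < N"
  shows "real j / N * cell_mass N \<mu> i j \<le> cell_mean N \<mu> i j"
    and "cell_mean N \<mu> i j \<le> (real j + 1) / N * cell_mass N \<mu> i j"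
    and "integrable (\<mu> i) (\<lambda>x. x * of_bool (cell N x = j))"
proof -
  interpret prob_space "\<mu> i" using \<mu> by (simp add: belief_distribution_def)
  have [measurable_cong]: "sets (\<mu> i) = sets borel" using \<mu> by (simp add: belief_distribution_def)
  have sp: "space (\<mu> i) = UNIV" using sets_eq_imp_space_eq[of "\<mu> i" borel] \<open>sets (\<mu> i) = sets borel\<close> by simp
  have mass: "(\<integral>x. c * of_bool (cell N x = j) \<partial>\<mu> i) = c * cell_mass N \<mu> i j" for c
  proof -
    have "(\<integral>x. c * of_bool (cell N x = j) \<partial>\<mu> i) = (\<integral>x. c * indicator {x. cell N x = j} x \<partial>\<mu> i)"
      by (rule Bochner_Integration.integral_cong) (auto simp: indicator_def)
    also have "\<dots> = c * cell_mass N \<mu> i j"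
      by (simp add: cell_mass_def sp)
    finally show ?thesis .
  qed
  have intc: "integrable (\<mu> i) (\<lambda>x. c * of_bool (cell N x = j))" for c :: real
    by (rule integrable_const_bound[where B = "\<bar>c\<bar>"]) (auto intro!: AE_I2)
  show int: "integrable (\<mu> i) (\<lambda>x. x * of_bool (cell N x = j))"
    by (rule integrable_const_bound[where B = 1]) (use AE_belief[OF \<mu>, of i] in \<open>auto elim!: AE_mp\<close>)
  show "real j / N * cell_mass N \<mu> i j \<le> cell_mean N \<mu> i j"
    unfolding cell_mean_def mass[symmetric]
    by (rule integral_mono_AE[OF intc int])
       (use AE_belief[OF \<mu>, of i] in eventually_elim, use cell_bounds(1)[OF N] in auto)
  show "cell_mean N \<mu> i j \<le> (real j + 1) / N * cell_mass N \<mu> i j"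
    unfolding cell_mean_def mass[symmetric]
    by (rule integral_mono_AE[OF int intc])
       (use AE_belief[OF \<mu>, of i] in eventually_elim, use cell_bounds(2)[OF N] in auto)
qed

text \<open>The cells are consecutive intervals, so \<open>(j + 1) / N \<le> j' / N\<close>
  separates the means of two cells. The multiplied-out form is the slab hypothesis of
  \<open>monotone_rearrangement\<close>.\<close>

lemma cell_mean_mono:
  assumes \<mu>: "belief_distribution \<mu>" and N: "0 < N" and j: "j < j'"
  shows "cell_mass N \<mu> i j' * cell_mean N \<mu> i j \<le> cell_mass N \<mu> i j * cell_mean N \<mu> i j'"
proof -
  have nn: "0 \<le> cell_mass N \<mu> i k" for k by (simp add: cell_mass_def)
  have "cell_mass N \<mu> i j' * cell_mean N \<mu> i j \<le> cell_mass N \<mu> i j' * ((real j + 1) / N * cell_mass N \<mu> i j)"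
    by (rule mult_left_mono[OF cell_mean_bounds(2)[OF \<mu> N] nn])
  also have "\<dots> \<le> cell_mass N \<mu> i j' * (real j' / N * cell_mass N \<mu> i j)"
    using j by (intro mult_left_mono mult_right_mono divide_right_mono nn) auto
  also have "\<dots> = cell_mass N \<mu> i j * (real j' / N * cell_mass N \<mu> i j')" by simp
  also have "\<dots> \<le> cell_mass N \<mu> i j * cell_mean N \<mu> i j'"
    by (rule mult_left_mono[OF cell_mean_bounds(1)[OF \<mu> N] nn])
  finally show ?thesis .
qed

lemma sum_cell_mean:
  assumes \<mu>: "belief_distribution \<mu>" and N: "0 < N"
  shows "(\<Sum>j\<le>N. cell_mean N \<mu> i j) = (\<integral>x. x \<partial>\<mu> i)"
proof -
  have "(\<Sum>j\<le>N. cell_mean N \<mu> i j) = (\<integral>x. (\<Sum>j\<le>N. x * of_bool (cell N x = j)) \<partial>\<mu> i)"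
    unfolding cell_mean_def
    by (rule Bochner_Integration.integral_sum[symmetric]) (rule cell_mean_bounds(3)[OF \<mu> N])
  also have "\<dots> = (\<integral>x. x \<partial>\<mu> i)"
  proof (rule Bochner_Integration.integral_cong)
    fix x
    have "x * of_bool (cell N x = j) = (if cell N x = j then x else 0)" for j by simp
    then show "(\<Sum>j\<le>N. x * of_bool (cell N x = j)) = x" using cell_le[of N x] by simp
  qed simp
  finally show ?thesis .
qed

section \<open>Step signals built from a table on the cells\<close>

lemma quantile_mono:
  assumes \<mu>: "belief_distribution \<mu>" and t: "t \<in> {0..1}" "t' \<in> {0..1}" "t \<le> t'"
  shows "quantile (\<mu> i) t \<le> quantile (\<mu> i) t'"
proof -
  have q: "quantile (\<mu> i) t' \<in> {0..1}" by (rule quantile_in_unit[OF \<mu> t(2)])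
  then have "t' \<le> measure (\<mu> i) {..quantile (\<mu> i) t'}"
    using quantile_le_iff[OF \<mu> t(2) q, of i] by simp
  then show ?thesis using quantile_le_iff[OF \<mu> t(1) q, of i] t(3) by linarith
qed

lemma cell_mass_quantile:
  assumes \<mu>: "belief_distribution \<mu>"
  shows "(\<integral>t. of_bool (cell N (quantile (\<mu> i) t) = j) \<partial>unit_interval) = cell_mass N \<mu> i j"
    and "{t \<in> {0..1}. cell N (quantile (\<mu> i) t) = j} \<in> sets unit_interval"
    and "measure unit_interval {t \<in> {0..1}. cell N (quantile (\<mu> i) t) = j} = cell_mass N \<mu> i j"
proof -
  note [measurable] = quantile_measurable[OF \<mu>]
  have "{t \<in> space unit_interval. cell N (quantile (\<mu> i) t) = j} \<in> sets unit_interval"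
    by measurable
  then show m: "{t \<in> {0..1}. cell N (quantile (\<mu> i) t) = j} \<in> sets unit_interval" by simp
  have "cell_mass N \<mu> i j = measure (distr unit_interval borel (quantile (\<mu> i))) {x. cell N x = j}"
    by (simp add: cell_mass_def distr_quantile[OF \<mu>])
  also have "\<dots> = measure unit_interval {t \<in> {0..1}. cell N (quantile (\<mu> i) t) = j}"
    by (subst measure_distr) (auto intro!: arg_cong[where f = "measure unit_interval"])
  finally show eq: "measure unit_interval {t \<in> {0..1}. cell N (quantile (\<mu> i) t) = j} = cell_mass N \<mu> i j"
    by simp
  have "(\<integral>t. of_bool (cell N (quantile (\<mu> i) t) = j) \<partial>unit_interval)
      = (\<integral>t. indicator {t \<in> {0..1}. cell N (quantile (\<mu> i) t) = j} t \<partial>unit_interval)"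
    by (rule Bochner_Integration.integral_cong) (auto simp: indicator_def)
  also have "\<dots> = cell_mass N \<mu> i j"
    using m eq by (simp add: Int_absorb2 subset_iff)
  finally show "(\<integral>t. of_bool (cell N (quantile (\<mu> i) t) = j) \<partial>unit_interval) = cell_mass N \<mu> i j" .
qed

text \<open>The cells partition the beliefs, not the uniform variables. Composing with the quantiles
  gives boxes whose side lengths are the cell masses.\<close>

definition grid_signal :: "nat \<Rightarrow> ('n::finite \<Rightarrow> real measure) \<Rightarrow> (('n \<Rightarrow> nat) \<Rightarrow> real) \<Rightarrow> ('n \<Rightarrow> real) \<Rightarrow> real" where
  "grid_signal N \<mu> b x = b (\<lambda>i. cell N (quantile (\<mu> i) (x i)))"

lemma sum_of_bool_eq_point:
  assumes "finite A" "z \<in> A"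
  shows "(\<Sum>k\<in>A. b k * of_bool (z = k)) = (b z :: real)"
proof -
  have "b k * of_bool (z = k) = (if z = k then b k else 0)" for k by simp
  then show ?thesis using assms by simp
qed

text \<open>Written with products of one-dimensional indicators, integrals factorise into cell
  masses.\<close>

lemma grid_signal_eq_sum:
  "grid_signal N \<mu> b x
    = (\<Sum>k | \<forall>l. k l \<le> N. b k * (\<Prod>l\<in>UNIV. of_bool (cell N (quantile (\<mu> l) (x l)) = k l)))"
proof -
  have "(\<Prod>l\<in>UNIV. of_bool (cell N (quantile (\<mu> l) (x l)) = k l))
      = (of_bool ((\<lambda>l. cell N (quantile (\<mu> l) (x l))) = k) :: real)" for k
    by (auto simp: fun_eq_iff)
  then show ?thesis
    unfolding grid_signal_def
    by (simp only:) (rule sum_of_bool_eq_point[symmetric], use finite_grid[of N] cell_le in auto)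
qed

lemma unit_valued_grid_signal:
  assumes \<mu>: "belief_distribution \<mu>" and b: "\<And>k. 0 \<le> b k" "\<And>k. b k \<le> 1"
  shows "unit_valued (grid_signal N \<mu> b)"
proof -
  note [measurable] = quantile_measurable[OF \<mu>]
  have "(\<lambda>x. \<Sum>k | \<forall>l. k l \<le> N. b k * (\<Prod>l\<in>UNIV. of_bool (cell N (quantile (\<mu> l) (x l)) = k l)))
      \<in> borel_measurable (cube UNIV)"
    by measurable
  then have "grid_signal N \<mu> b \<in> borel_measurable (cube UNIV)"
    by (simp add: grid_signal_eq_sum[abs_def])
  then show ?thesis using b by (simp add: unit_valued_def grid_signal_def)
qed

lemma integral_prod_cells:
  assumes \<mu>: "belief_distribution \<mu>" and I: "finite I"
  shows "(\<integral>x. (\<Prod>l\<in>I. of_bool (cell N (quantile (\<mu> l) (x l)) = k l)) \<partial>cube I) = (\<Prod>l\<in>I. cell_mass N \<mu> l (k l))"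
    and "integrable (cube I) (\<lambda>x. \<Prod>l\<in>I. of_bool (cell N (quantile (\<mu> l) (x l)) = k l) :: real)"
proof -
  interpret product_sigma_finite "\<lambda>_. unit_interval" by standard
  note [measurable] = quantile_measurable[OF \<mu>]
  have int: "integrable unit_interval (\<lambda>t. of_bool (cell N (quantile (\<mu> l) t) = k l) :: real)" for l
    by (rule unit_interval.integrable_const_bound[where B = 1]) auto
  show "(\<integral>x. (\<Prod>l\<in>I. of_bool (cell N (quantile (\<mu> l) (x l)) = k l)) \<partial>cube I) = (\<Prod>l\<in>I. cell_mass N \<mu> l (k l))"
    unfolding cube_def using product_integral_prod[OF I, of "\<lambda>l t. of_bool (cell N (quantile (\<mu> l) t) = k l) :: real"] int
    by (simp add: cell_mass_quantile(1)[OF \<mu>])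
  show "integrable (cube I) (\<lambda>x. \<Prod>l\<in>I. of_bool (cell N (quantile (\<mu> l) (x l)) = k l) :: real)"
    unfolding cube_def by (rule product_integrable_prod[OF I int])
qed

lemma integral_grid_signal:
  assumes \<mu>: "belief_distribution \<mu>"
  shows "(\<integral>x. grid_signal N \<mu> b x \<partial>cube UNIV) = (\<Sum>j\<le>N. slab_sum N (cell_mass N \<mu>) b i j)"
proof -
  have "(\<integral>x. grid_signal N \<mu> b x \<partial>cube UNIV)
      = (\<Sum>k | \<forall>l. k l \<le> N. (\<Prod>l\<in>UNIV. cell_mass N \<mu> l (k l)) * b k)"
    unfolding grid_signal_eq_sum using integral_prod_cells[OF \<mu>, of UNIV]
    by (subst Bochner_Integration.integral_sum) (auto simp: mult.commute)
  also have "\<dots> = (\<Sum>j\<le>N. \<Sum>k | k \<in> {k. \<forall>l. k l \<le> N} \<and> k i = j. (\<Prod>l\<in>UNIV. cell_mass N \<mu> l (k l)) * b k)"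
    by (rule sum.group[symmetric]) (auto simp: finite_grid)
  finally show ?thesis by (simp add: slab_sum_def)
qed

text \<open>The marginal at \<open>t\<close> is the slab average of the cell that contains the
  quantile at \<open>t\<close>; multiplying by the mass covers null cells.\<close>

lemma marginal_grid_signal:
  assumes \<mu>: "belief_distribution \<mu>" and j: "cell N (quantile (\<mu> i) t) = j"
  shows "cell_mass N \<mu> i j * marginal (grid_signal N \<mu> b) i t = slab_sum N (cell_mass N \<mu>) b i j"
proof -
  have split: "(\<Prod>l\<in>UNIV. g l) = g i * (\<Prod>l\<in>UNIV - {i}. g l)" for g :: "'a \<Rightarrow> real"
    by (rule prod.remove) auto
  have "grid_signal N \<mu> b (x(i := t)) = (\<Sum>k | \<forall>l. k l \<le> N. b k * of_bool (j = k i) *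
      (\<Prod>l\<in>UNIV - {i}. of_bool (cell N (quantile (\<mu> l) (x l)) = k l)))" for x
    unfolding grid_signal_eq_sum split using j by (intro sum.cong) (auto simp: mult.assoc intro!: prod.cong)
  then have "marginal (grid_signal N \<mu> b) i t = (\<Sum>k | \<forall>l. k l \<le> N. b k * of_bool (j = k i) *
      (\<Prod>l\<in>UNIV - {i}. cell_mass N \<mu> l (k l)))"
    unfolding marginal_def using integral_prod_cells[OF \<mu>, of "UNIV - {i}"]
    by (simp add: Bochner_Integration.integral_sum)
  then have "cell_mass N \<mu> i j * marginal (grid_signal N \<mu> b) i t
      = cell_mass N \<mu> i j * (\<Sum>k | \<forall>l. k l \<le> N. b k * of_bool (j = k i) *
      (\<Prod>l\<in>UNIV - {i}. cell_mass N \<mu> l (k l)))" by (simp only:)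
  also have "\<dots> = (\<Sum>k | \<forall>l. k l \<le> N. of_bool (j = k i) * ((\<Prod>l\<in>UNIV. cell_mass N \<mu> l (k l)) * b k))"
    unfolding sum_distrib_left split by (intro sum.cong) (auto simp: mult_ac)
  also have "\<dots> = slab_sum N (cell_mass N \<mu>) b i j"
    unfolding slab_sum_def by (rule sum.mono_neutral_cong_right) (auto simp: finite_grid)
  finally show ?thesis .
qed

lemma cell_mass_nonneg: "0 \<le> cell_mass N \<mu> i j"
  by (simp add: cell_mass_def)

text \<open>The rearranged table is monotone only between tuples of cells with positive mass. Taking
  the largest value below \<open>k\<close> makes it monotone everywhere without changing it on
  \<open>S\<close>.\<close>

lemma monotone_extension:
  fixes b :: "'a::order \<Rightarrow> real"
  assumes S: "finite S" and b: "\<And>k. 0 \<le> b k" "\<And>k. b k \<le> 1"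
    and mono: "\<And>k k'. k \<in> S \<Longrightarrow> k' \<in> S \<Longrightarrow> k \<le> k' \<Longrightarrow> b k \<le> b k'"
  obtains c where "\<And>k. 0 \<le> c k" "\<And>k. c k \<le> 1" "mono c" "\<And>k. k \<in> S \<Longrightarrow> c k = b k"
proof -
  define c where "c k = Max (insert 0 (b ` {k' \<in> S. k' \<le> k}))" for k
  have fin: "finite (insert 0 (b ` {k' \<in> S. k' \<le> k}))" for k using S by simp
  show ?thesis
  proof (rule that[of c])
    show "0 \<le> c k" for k unfolding c_def by (rule Max_ge[OF fin]) simp
    show "c k \<le> 1" for k unfolding c_def by (rule Max.boundedI[OF fin]) (use b in auto)
    show "mono c"
      unfolding c_def by (rule monoI, rule Max_mono[OF _ _ fin]) (auto intro: order_trans)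
    show "c k = b k" if "k \<in> S" for k
      unfolding c_def by (rule Max_eqI[OF fin]) (use b mono that in auto)
  qed
qed

lemma slab_sum_cong:
  assumes "\<And>k. (\<And>l. k l \<le> L) \<Longrightarrow> (\<And>l. m l (k l) \<noteq> 0) \<Longrightarrow> b k = c k"
  shows "slab_sum L m b i j = slab_sum L m c i j"
  unfolding slab_sum_def
proof (rule sum.cong[OF refl])
  fix k :: "'a \<Rightarrow> nat" assume k: "k \<in> {k. (\<forall>l. k l \<le> L) \<and> k i = j}"
  show "(\<Prod>l\<in>UNIV. m l (k l)) * b k = (\<Prod>l\<in>UNIV. m l (k l)) * c k"
  proof (cases "\<exists>l. m l (k l) = 0")
    case True
    then have "(\<Prod>l\<in>UNIV. m l (k l)) = 0" by (auto intro: prod_zero)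
    then show ?thesis by simp
  next
    case False
    then show ?thesis using assms[of k] k by simp
  qed
qed

text \<open>Almost everywhere the marginal and the quantile lie in the same interval from
  \<open>j / N\<close> to \<open>(j + 1) / N\<close>, the marginal because it is the mean belief of
  that cell. Each component is therefore off by at most \<open>1 / N\<close>.\<close>

lemma mono_signal_from_grid:
  fixes \<mu> :: "'n::finite \<Rightarrow> real measure"
  assumes \<mu>: "belief_distribution \<mu>" and N: "0 < N"
    and p: "\<And>i. (\<integral>x. x \<partial>\<mu> i) = p"
    and a: "\<And>k. 0 \<le> a k" "\<And>k. a k \<le> 1"
    and slab: "\<And>i j. slab_sum N (cell_mass N \<mu>) a i j = (if j \<le> N then cell_mean N \<mu> i j else 0)"
  obtains f where "f \<in> mono_signals p" "norm (marginals f - quantile_tuple \<mu>) \<le> CARD('n) / N"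
proof -
  let ?m = "cell_mass N \<mu>"
  obtain b where b: "\<And>k. 0 \<le> b k" "\<And>k. b k \<le> 1"
    and bslab: "\<And>i j. slab_sum N ?m b i j = slab_sum N ?m a i j"
    and bmono: "\<And>k k'. k \<le> k' \<Longrightarrow> (\<And>l. k' l \<le> N) \<Longrightarrow> (\<And>l. 0 < ?m l (k l)) \<Longrightarrow> (\<And>l. 0 < ?m l (k' l)) \<Longrightarrow> b k \<le> b k'"
    by (rule monotone_rearrangement[of ?m a N])
       (use a cell_mass_nonneg cell_mean_mono[OF \<mu> N] in \<open>auto simp: slab\<close>)
  define S where "S = {k :: 'n \<Rightarrow> nat. (\<forall>l. k l \<le> N) \<and> (\<forall>l. 0 < ?m l (k l))}"
  have "finite S" unfolding S_def by (rule finite_slab)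
  then obtain c where c: "\<And>k. 0 \<le> c k" "\<And>k. c k \<le> 1" "mono c" "\<And>k. k \<in> S \<Longrightarrow> c k = b k"
    by (rule monotone_extension[of S b]) (use b bmono in \<open>auto simp: S_def\<close>)
  have cslab: "slab_sum N ?m c i j = (if j \<le> N then cell_mean N \<mu> i j else 0)" for i j
  proof -
    have "slab_sum N ?m c i j = slab_sum N ?m b i j"
    proof (rule slab_sum_cong)
      fix k assume "\<And>l. k l \<le> N" "\<And>l. ?m l (k l) \<noteq> 0"
      then have "k \<in> S" using cell_mass_nonneg[of N \<mu>] by (simp add: S_def less_le)
      then show "c k = b k" by (rule c(4))
    qed
    then show ?thesis by (simp add: bslab slab)
  qed
  define f where "f = grid_signal N \<mu> c"
  have fu: "unit_valued f" unfolding f_def by (rule unit_valued_grid_signal[OF \<mu> c(1,2)])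
  have "(\<integral>x. f x \<partial>cube UNIV) = p"
    \<comment> \<open>The mean can be computed by slicing along any coordinate;
      \<open>undefined\<close> is an arbitrary one.\<close>
    unfolding f_def integral_grid_signal[OF \<mu>, of N c undefined] cslab
    using sum_cell_mean[OF \<mu> N, of undefined] p by simp
  moreover have "ae_mono f"
    unfolding ae_mono_def
  proof (intro bexI[of _ "{}"] ballI impI)
    fix x y :: "'n \<Rightarrow> real"
    assume x: "x \<in> space (cube UNIV) - {}" and y: "y \<in> space (cube UNIV) - {}" and xy: "x \<le> y"
    have "cell N (quantile (\<mu> i) (x i)) \<le> cell N (quantile (\<mu> i) (y i))" for i
      by (rule cell_mono, rule quantile_mono[OF \<mu>])
         (use x y xy in \<open>auto simp: space_cube PiE_def Pi_def le_fun_def\<close>)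
    then show "f x \<le> f y"
      unfolding f_def grid_signal_def by (intro monoD[OF c(3)] le_funI)
  qed simp
  ultimately have fm: "f \<in> mono_signals p"
    using fu by (simp add: mono_signals_def signals_eq)
  have close: "norm ((marginals f - quantile_tuple \<mu>) $ i) \<le> 1 / N" for i
  proof -
    \<comment> \<open>Slab sums say nothing about the marginal on cells of mass 0, but almost no
      \<open>t\<close> has its quantile there.\<close>
    have "AE t in unit_interval. \<forall>j\<in>{j. j \<le> N \<and> ?m i j = 0}. cell N (quantile (\<mu> i) t) \<noteq> j"
    proof (rule AE_finite_allI)
      fix j assume "j \<in> {j. j \<le> N \<and> ?m i j = 0}"
      then have "unit_interval.prob {t \<in> {0..1}. cell N (quantile (\<mu> i) t) = j} = 0"
        using cell_mass_quantile(3)[OF \<mu>, where N = N and i = i and j = j] by simp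
      then have "AE t in unit_interval. t \<notin> {t \<in> {0..1}. cell N (quantile (\<mu> i) t) = j}"
        using unit_interval.prob_eq_0[OF cell_mass_quantile(2)[OF \<mu>]] by blast
      then show "AE t in unit_interval. cell N (quantile (\<mu> i) t) \<noteq> j"
        using AE_space by eventually_elim simp
    qed simp
    then have AE: "AE t in unit_interval. \<bar>marginal f i t - quantile (\<mu> i) t\<bar> \<le> 1 / N"
      using AE_space
    proof eventually_elim
      case (elim t)
      define j where "j = cell N (quantile (\<mu> i) t)"
      have jN: "j \<le> N" by (simp add: j_def cell_le)
      have pos: "0 < ?m i j" using elim(1) jN cell_mass_nonneg[of N \<mu> i j] by (auto simp: j_def less_le)
      have "?m i j * marginal f i t = cell_mean N \<mu> i j"
        unfolding f_def using marginal_grid_signal[OF \<mu> j_def[symmetric]] cslab jN by simp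
      then have "?m i j * (real j / N) \<le> ?m i j * marginal f i t"
        "?m i j * marginal f i t \<le> ?m i j * ((real j + 1) / N)"
        using cell_mean_bounds(1,2)[OF \<mu> N, where i = i and j = j] by (simp_all add: mult.commute)
      then have "real j / N \<le> marginal f i t" "marginal f i t \<le> (real j + 1) / N"
        by (simp_all only: mult_le_cancel_left_pos[OF pos])
      moreover have "real j / N \<le> quantile (\<mu> i) t" "quantile (\<mu> i) t \<le> (real j + 1) / N"
        unfolding j_def using cell_bounds[OF N quantile_in_unit[OF \<mu>]] elim(2) by auto
      ultimately show ?case by (simp add: add_divide_distrib abs_le_iff)
    qed
    have "norm ((marginals f - quantile_tuple \<mu>) $ i)
        = (\<integral>t. \<bar>marginal f i t - quantile (\<mu> i) t\<bar> \<partial>unit_interval)"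
      by (simp add: marginals_def quantile_tuple_def norm_L1_class_diff quantile_integrable[OF \<mu>]
          unit_valued_integrable_marginal[OF fu])
    also have "\<dots> \<le> 1 / N"
      by (rule unit_interval.integral_le_const[OF _ AE])
         (simp add: quantile_integrable[OF \<mu>] unit_valued_integrable_marginal[OF fu])
    finally show ?thesis .
  qed
  have "norm (marginals f - quantile_tuple \<mu>) \<le> (\<Sum>i\<in>UNIV. norm ((marginals f - quantile_tuple \<mu>) $ i))"
    by (rule norm_vec_le_sum)
  also have "\<dots> \<le> (\<Sum>i\<in>(UNIV :: 'n set). 1 / N)" by (rule sum_mono) (rule close)
  finally have "norm (marginals f - quantile_tuple \<mu>) \<le> CARD('n) / N" by simp
  then show ?thesis using that fm by blast
qed

section \<open>From a private private structure to a table\<close>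

text \<open>For the last claim: the event that the posterior lies in \<open>B\<close> belongs to the
  sigma-algebra generated by the signal, so on it the state indicator may be replaced by the
  posterior.\<close>

lemma posterior_properties:
  assumes "information_structure p M \<omega> S s"
  shows "posterior M \<omega> S s i \<in> borel_measurable (vimage_algebra (space M) (s i) (S i))"
    and "AE w in M. posterior M \<omega> S s i w \<in> {0..1}"
    and "B \<in> sets borel \<Longrightarrow> measure M ({w \<in> space M. \<omega> w = 1} \<inter> (posterior M \<omega> S s i -` B \<inter> space M))
      = (\<integral>w. posterior M \<omega> S s i w * indicator B (posterior M \<omega> S s i w) \<partial>M)"
proof -
  interpret prob_space M using assms by (simp add: information_structure_def)
  have s: "s i \<in> M \<rightarrow>\<^sub>M S i" and \<omega>[measurable]: "\<omega> \<in> M \<rightarrow>\<^sub>M count_space {0, 1}"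
    using assms by (auto simp: information_structure_def)
  let ?F = "vimage_algebra (space M) (s i) (S i)"
  interpret F: sigma_finite_subalgebra M ?F
    by (rule sigma_finite_subalgebra_vimage[OF prob_space_axioms s])
  define E where "E = {w \<in> space M. \<omega> w = 1}"
  have E[measurable]: "E \<in> sets M"
  proof -
    have "E = \<omega> -` {1} \<inter> space M" by (auto simp: E_def)
    then show ?thesis using \<omega> by (auto intro: measurable_sets)
  qed
  have Ei: "integrable M (indicator E :: _ \<Rightarrow> real)"
    by (rule integrable_real_indicator) (simp_all add: less_top[symmetric])
  let ?P = "posterior M \<omega> S s i"
  have P: "?P = real_cond_exp M ?F (indicator E)" by (simp add: posterior_def E_def)
  show Pm: "?P \<in> borel_measurable ?F" unfolding P by (rule borel_measurable_cond_exp)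
  have "AE w in M. 0 \<le> ?P w" "AE w in M. ?P w \<le> 1"
    unfolding P by (rule F.real_cond_exp_ge_c[OF Ei], simp) (rule F.real_cond_exp_le_c[OF Ei], simp add: indicator_def)
  then show "AE w in M. ?P w \<in> {0..1}" by eventually_elim simp
  assume B: "B \<in> sets borel"
  have A: "?P -` B \<inter> space M \<in> sets ?F" using measurable_sets[OF Pm B] by simp
  then have AM: "?P -` B \<inter> space M \<in> sets M" using F.subalg by (auto simp: subalgebra_def)
  have "measure M (E \<inter> (?P -` B \<inter> space M)) = (\<integral>w. indicator (E \<inter> (?P -` B \<inter> space M)) w \<partial>M)"
    using E AM by (simp add: Int_absorb2 sets.sets_into_space)
  also have "\<dots> = (\<integral>w\<in>?P -` B \<inter> space M. indicator E w \<partial>M)"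
    unfolding set_lebesgue_integral_def
    by (rule Bochner_Integration.integral_cong) (auto simp: indicator_def)
  also have "\<dots> = (\<integral>w\<in>?P -` B \<inter> space M. ?P w \<partial>M)"
    unfolding P by (rule F.real_cond_exp_intA[OF Ei A[unfolded P]])
  also have "\<dots> = (\<integral>w. ?P w * indicator B (?P w) \<partial>M)"
    unfolding set_lebesgue_integral_def
    by (rule Bochner_Integration.integral_cong) (auto simp: indicator_def)
  finally show "measure M ({w \<in> space M. \<omega> w = 1} \<inter> (?P -` B \<inter> space M))
      = (\<integral>w. ?P w * indicator B (?P w) \<partial>M)" by (simp add: E_def)
qed

text \<open>Each posterior generates a smaller sigma-algebra than its signal does.\<close>

lemma indep_posteriors:
  assumes "private_private p M \<omega> S s"
  shows "prob_space.indep_vars M (\<lambda>_. borel) (posterior M \<omega> S s) UNIV"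
proof -
  have info: "information_structure p M \<omega> S s" using assms by (simp add: private_private_def)
  interpret prob_space M using info by (simp add: information_structure_def)
  have s: "s i \<in> M \<rightarrow>\<^sub>M S i" for i using info by (auto simp: information_structure_def)
  have sets: "sets (vimage_algebra (space M) (s i) (S i)) = {s i -` A \<inter> space M | A. A \<in> sets (S i)}" for i
    by (rule sets_vimage_algebra2) (use measurable_space[OF s] in auto)
  have Pm: "posterior M \<omega> S s i -` B \<inter> space M \<in> {s i -` A \<inter> space M | A. A \<in> sets (S i)}"
    if "B \<in> sets borel" for i B
    using measurable_sets[OF posterior_properties(1)[OF info] that] by (simp add: sets)
  have "indep_sets (\<lambda>i. {s i -` A \<inter> space M | A. A \<in> sets (S i)}) UNIV"
    using assms by (simp add: private_private_def indep_vars_def2)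
  then have "indep_sets (\<lambda>i. {posterior M \<omega> S s i -` A \<inter> space M | A. A \<in> sets borel}) UNIV"
    by (rule indep_sets_mono_sets) (use Pm in blast)
  then show ?thesis
    unfolding indep_vars_def2 by (auto simp: posterior_def)
qed

text \<open>Rounding yields monotone signals whose marginals come arbitrarily close to the
  quantiles; that set of marginals is closed.\<close>

lemma quantiles_in_closure_if_feasible:
  fixes \<mu> :: "'n::finite \<Rightarrow> real measure" and M :: "'w measure" and S :: "'n \<Rightarrow> 's measure"
  assumes p: "p < 1" and \<mu>: "belief_distribution \<mu>"
    and priv: "private_private p M \<omega> S s"
    and law: "\<And>i. distr M borel (posterior M \<omega> S s i) = \<mu> i"
  shows "quantile_tuple \<mu> \<in> closure (convex hull (Q_star p))"
proof -
  have info: "information_structure p M \<omega> S s" using priv by (simp add: private_private_def)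
  interpret prob_space M using info by (simp add: information_structure_def)
  define P where "P = posterior M \<omega> S s"
  define E where "E = {w \<in> space M. \<omega> w = 1}"
  have Pm [measurable]: "P i \<in> borel_measurable M" for i by (simp add: P_def posterior_def)
  have [measurable]: "\<omega> \<in> M \<rightarrow>\<^sub>M count_space {0, 1}" using info by (auto simp: information_structure_def)
  have E[measurable]: "E \<in> sets M"
  proof -
    have "E = \<omega> -` {1} \<inter> space M" by (auto simp: E_def)
    then show ?thesis by (auto intro: measurable_sets)
  qed
  have PE: "prob E = p" using info by (simp add: information_structure_def E_def)
  have cond: "prob (E \<inter> (P i -` B \<inter> space M)) = (\<integral>x. x * indicator B x \<partial>\<mu> i)" if "B \<in> sets borel" for i B
  proof -
    have "(\<integral>x. x * indicator B x \<partial>\<mu> i) = (\<integral>w. P i w * indicator B (P i w) \<partial>M)"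
      unfolding law[symmetric] P_def[symmetric] using that[measurable]
      by (intro integral_distr) measurable
    then show ?thesis using posterior_properties(3)[OF info that, of i] by (simp add: P_def E_def)
  qed
  have mean: "(\<integral>x. x \<partial>\<mu> i) = p" for i
    using cond[of UNIV i] PE E by (simp add: Int_absorb2 sets.sets_into_space)
  have "\<exists>y\<in>marginals ` mono_signals p. dist y (quantile_tuple \<mu>) < e" if e: "0 < e" for e
  proof -
    obtain N :: nat where N: "CARD('n) / e < N" using reals_Archimedean2 by blast
    have "0 < CARD('n) / e" using e by simp
    then have N0: "0 < N" using N by (metis of_nat_0_less_iff order_less_trans)
    let ?m = "cell_mass N \<mu>"
    define D where "D k = {w \<in> space M. \<forall>i. cell N (P i w) = k i}" for k
    \<comment> \<open>The conditional probability of state 1 given all rounded posteriors. On null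
      events the division gives 0, which still lies in [0,1].\<close>
    define a where "a k = prob (E \<inter> D k) / prob (D k)" for k
    have D [measurable]: "D k \<in> sets M" for k unfolding D_def by measurable
    \<comment> \<open>Privacy enters here: independence of the posteriors gives the boxes their
      product weights.\<close>
    have PD: "prob (D k) = (\<Prod>i\<in>UNIV. ?m i (k i))" for k
    proof -
      have "D k = (\<Inter>i\<in>UNIV. P i -` {x. cell N x = k i} \<inter> space M)" by (auto simp: D_def)
      also have "prob \<dots> = (\<Prod>i\<in>UNIV. prob (P i -` {x. cell N x = k i} \<inter> space M))"
        by (rule indep_varsD_finite[OF indep_posteriors[OF priv, folded P_def]]) auto
      also have "\<dots> = (\<Prod>i\<in>UNIV. ?m i (k i))"
        unfolding cell_mass_def law[symmetric] P_def[symmetric]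
        by (intro prod.cong refl) (subst measure_distr, auto)
      finally show ?thesis .
    qed
    have ED: "prob (E \<inter> D k) \<le> prob (D k)" for k by (rule finite_measure_mono) auto
    have a01: "0 \<le> a k" "a k \<le> 1" for k
      using ED by (auto simp: a_def divide_le_eq_1 less_le)
    have wa: "(\<Prod>l\<in>UNIV. ?m l (k l)) * a k = prob (E \<inter> D k)" for k
    proof (cases "prob (D k) = 0")
      case True
      then have "prob (E \<inter> D k) = 0" using ED[of k] measure_nonneg[of M "E \<inter> D k"] by linarith
      then show ?thesis using True by (simp flip: PD)
    qed (simp add: a_def flip: PD)
    have slab: "slab_sum N ?m a i j = (if j \<le> N then cell_mean N \<mu> i j else 0)" for i j
    proof (cases "j \<le> N")
      case False
      then have empty: "{k :: 'n \<Rightarrow> nat. (\<forall>l. k l \<le> N) \<and> k i = j} = {}" by auto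
      show ?thesis unfolding slab_sum_def empty using False by simp
    next
      case True
      let ?K = "{k :: 'n \<Rightarrow> nat. (\<forall>l. k l \<le> N) \<and> k i = j}"
      have "slab_sum N ?m a i j = (\<Sum>k\<in>?K. prob (E \<inter> D k))"
        unfolding slab_sum_def wa ..
      also have "\<dots> = prob (\<Union>k\<in>?K. E \<inter> D k)"
        by (rule finite_measure_finite_Union[symmetric])
           (auto simp: finite_slab disjoint_family_on_def D_def fun_eq_iff)
      also have "(\<Union>k\<in>?K. E \<inter> D k) = E \<inter> (P i -` {x. cell N x = j} \<inter> space M)"
      proof (intro equalityI subsetI)
        fix w assume w: "w \<in> E \<inter> (P i -` {x. cell N x = j} \<inter> space M)"
        then have "(\<lambda>l. cell N (P l w)) \<in> ?K" "w \<in> E \<inter> D (\<lambda>l. cell N (P l w))"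
          by (auto simp: D_def cell_le)
        then show "w \<in> (\<Union>k\<in>?K. E \<inter> D k)" by (rule UN_I[where a = "\<lambda>l. cell N (P l w)"])
      next
        fix w assume "w \<in> (\<Union>k\<in>?K. E \<inter> D k)"
        then obtain k where "k \<in> ?K" "w \<in> E" "w \<in> D k" by blast
        then show "w \<in> E \<inter> (P i -` {x. cell N x = j} \<inter> space M)" by (auto simp: D_def)
      qed
      also have "prob \<dots> = (\<integral>x. x * indicator {x. cell N x = j} x \<partial>\<mu> i)"
        by (rule cond) measurable
      also have "\<dots> = cell_mean N \<mu> i j"
        unfolding cell_mean_def by (rule Bochner_Integration.integral_cong) (auto simp: indicator_def)
      finally show ?thesis using True by simp
    qed
    obtain f where f: "f \<in> mono_signals p" "norm (marginals f - quantile_tuple \<mu>) \<le> CARD('n) / N"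
      using mono_signal_from_grid[OF \<mu> N0 mean a01 slab] .
    have "CARD('n) / N < e" using N N0 e by (simp add: field_simps)
    then have "dist (marginals f) (quantile_tuple \<mu>) < e" using f(2) by (simp add: dist_norm)
    then show ?thesis using f(1) by blast
  qed
  then have "quantile_tuple \<mu> \<in> closure (marginals ` mono_signals p)"
    by (simp add: closure_approachable)
  then show ?thesis
    unfolding closure_hull_Q_star[OF p] by (simp add: closure_closed closed_marginals_mono_signals)
qed

text \<open>The equivalence is stated for the types of the canonical structure
  \<open>signal_space\<close>. The second conjunct gives necessity for arbitrary types of sample
  points and signals, so the choice of these types excludes no feasible distribution.\<close>

theorem proposition15:
  fixes p :: real
  assumes "0 < p" "p < 1"
  shows "(\<forall>\<mu> :: 'n::finite \<Rightarrow> real measure. belief_distribution \<mu> \<longrightarrow>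
            (feasible_privately TYPE(nat \<times> ('n \<Rightarrow> real)) TYPE(real) p \<mu> \<longleftrightarrow>
             quantile_tuple \<mu> \<in> closure (convex hull (Q_star p)))) \<and>
         (\<forall>\<mu> :: 'n \<Rightarrow> real measure. belief_distribution \<mu> \<longrightarrow>
            feasible_privately TYPE('w) TYPE('s) p \<mu> \<longrightarrow>
            quantile_tuple \<mu> \<in> closure (convex hull (Q_star p))) \<and>
         {q :: L1 ^ 'n. q extreme_point_of closure (convex hull (Q_star p))} \<subseteq> Q_star p"
proof (intro conjI allI impI subsetI)
  fix \<mu> :: "'n \<Rightarrow> real measure" assume \<mu>: "belief_distribution \<mu>"
  show "feasible_privately TYPE(nat \<times> ('n \<Rightarrow> real)) TYPE(real) p \<mu> \<longleftrightarrow>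
      quantile_tuple \<mu> \<in> closure (convex hull (Q_star p))"
  proof
    assume "feasible_privately TYPE(nat \<times> ('n \<Rightarrow> real)) TYPE(real) p \<mu>"
    then show "quantile_tuple \<mu> \<in> closure (convex hull (Q_star p))"
      unfolding feasible_privately_def using quantiles_in_closure_if_feasible[OF assms(2) \<mu>] by blast
  next
    assume "quantile_tuple \<mu> \<in> closure (convex hull (Q_star p))"
    then obtain f where "f \<in> mono_signals p" "quantile_tuple \<mu> = marginals f"
      unfolding closure_hull_Q_star[OF assms(2)] by blast
    then show "feasible_privately TYPE(nat \<times> ('n \<Rightarrow> real)) TYPE(real) p \<mu>"
      using feasible_if_quantiles_are_marginals[OF \<mu>] by (auto simp: mono_signals_def)
  qed
  assume "feasible_privately TYPE('w) TYPE('s) p \<mu>"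
  then show "quantile_tuple \<mu> \<in> closure (convex hull (Q_star p))"
    unfolding feasible_privately_def using quantiles_in_closure_if_feasible[OF assms(2) \<mu>] by blast
next
  fix q :: "L1 ^ 'n" assume "q \<in> {q. q extreme_point_of closure (convex hull (Q_star p))}"
  then show "q \<in> Q_star p" using extreme_points_subset_Q_star[OF assms(2)] by simp
qed

end
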